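(* Let $T$ be a Hopf algebra with bijective antipode $S$, $A$ a braided-commutative left-right Yetter-Drinfeld $T$-module algebra, and $H=A\sharp T$ the smash product algebra with the scalar extension structure maps $\alpha,\beta,\Delta,\epsilon$. Let $\mathcal{B}\subset H\otimes_{\bm k}H$ be the subalgebra generated by $\{a\otimes 1,\ S a_{[1]}\otimes a_{[0]}\mid a\in A\}\cup\Delta_T(T)$, and let $\mathcal{B}^+$ be the two-sided ideal of $\mathcal{B}$ generated by $\{a\otimes 1-S a_{[1]}\otimes a_{[0]}\mid a\in A\}$. Let $\tau\colon H\to H$ be given by $\tau(a\sharp t)=S(t)\,S^2(a_{[1]})\cdot a_{[0]}$. Then: (i) $\mu(\mathrm{id}\otimes_{\bm k}\tau)\,\mathcal{B}^+=\{0\}$, where $\mu$ is the multiplication of $H$; (ii) $\tau$ makes the left $A$-bialgebroid $(H,\mu,\alpha,\beta,\Delta,\epsilon)$ with balancing subalgebra $\mathcal{B}$ into a Hopf $A$-algebroid with balancing subalgebra $\mathcal{B}$.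
   Context: Let $\bm k$ be a field, $\otimes=\otimes_{\bm k}$, Sweedler notation $\Delta_T(t)=t_{(1)}\otimes t_{(2)}$. **Braided-commutative Yetter-Drinfeld algebra.** $T$ is a Hopf $\bm k$-algebra with coproduct $\Delta_T$, counit $\epsilon_T$ and bijective antipode $S$. $A$ is a unital associative algebra with a left $T$-action $\blacktriangleright$ satisfying $t\blacktriangleright(ab)=(t_{(1)}\blacktriangleright a)(t_{(2)}\blacktriangleright b)$, $t\blacktriangleright1=\epsilon_T(t)1$, and a right $T$-coaction $a\mapsto a_{[0]}\otimes a_{[1]}$ which is an algebra morphism $A\to A\otimes T^{\mathrm{op}}$, such that $(t_{(1)}\blacktriangleright a_{[0]})\otimes t_{(2)}a_{[1]}=(t_{(2)}\blacktriangleright a)_{[0]}\otimes(t_{(2)}\blacktriangleright a)_{[1]}t_{(1)}$ and $x_{[0]}(x_{[1]}\blacktriangleright a)=ax$ for all $t\in T$, $a,x\in A$. **Scalar extension.** $H=A\sharp T$ is $A\otimes T$ with product $(a\sharp t)(a'\sharp t')=a(t_{(1)}\blacktriangleright a')\sharp t_{(2)}t'$ and unit $1\sharp1$; $A\cong A\sharp1$ and $T\cong1\sharp T$ are viewed as subalgebras, and $T\otimes T\subset H\otimes H$, so $\Delta_T(T)\subset H\otimes H$. Structure maps: $\alpha(a)=a\sharp1$, $\beta(a)=a_{[0]}\sharp a_{[1]}$, $\Delta(a\sharp t)=(a\sharp t_{(1)})\otimes_A(1\sharp t_{(2)})$, $\epsilon(a\sharp t)=a\,\epsilon_T(t)$.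 **Bialgebroids with balancing subalgebra.** An $A\otimes A^{\mathrm{op}}$-ring $(H,\mu,\alpha,\beta)$ is a unital algebra with unital algebra homomorphisms $\alpha\colon A\to H$, $\beta\colon A^{\mathrm{op}}\to H$ with commuting images. An $A$-coring $(H,\Delta,\epsilon)$ is an $A$-bimodule with coassociative bimodule map $\Delta\colon H\to H\otimes_AH$ and a bimodule map counit $\epsilon\colon H\to A$. Let $\pi\colon H\otimes H\to H\otimes_A H$ be the projection and $I_A=\operatorname{Ker}\pi$, the right ideal generated by all $\beta(a)\otimes1-1\otimes\alpha(a)$. A left $A$-bialgebroid with balancing subalgebra $\mathcal{B}$ consists of such a ring and coring and a (not necessarily unital) subalgebra $\mathcal{B}\subset H\otimes H$ with: (C1) the $A$-bimodule structure is $a.h.b=\alpha(a)\beta(b)h$; (C2) $h\triangleright a:=\epsilon(h\alpha(a))$ is an action of $H$ on $A$; (C3MI) $I_A\cap\mathcal{B}$ is a two-sided ideal in $\mathcal{B}$; (C3Ma) $\mathrm{Im}\,\Delta\subset\mathcal{B}/(I_A\cap\mathcal{B})$ (identified with $\pi(\mathcal{B})\subset H\otimes_AH$); (C3Mb) $\Delta\colon H\to\mathcal{B}/(I_A\cap\mathcal{B})$ is a homomorphism of algebras (multiplicative, with $\Delta(1)=1\otimes_A1$). **Hopf $A$-algebroid with balancing subalgebra $\mathcal{B}$.** Such a bialgebroid with an algebra antihomomorphism $\tau\colon H\to H$ (antipode) such that $\mu(\mathrm{id}\otimes_{\bm k}\tau)(I_A\cap\mathcal{B})=0$; $\tau\beta=\alpha$;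 $\mu(\mathrm{id}\otimes_A\tau)\Delta=\alpha\epsilon$ (left side computed on any representative of $\Delta(h)$ in $\mathcal{B}$); $\mu(\tau\otimes_A\mathrm{id})\Delta=\beta\epsilon\tau$. *)

theory Defs
  imports Complex_Main "HOL-Library.Poly_Mapping"
begin

section \<open>Free vector spaces, quotients and tensor products\<close>

text \<open>Vector spaces over a field are given, as in the library, by an additive
  group (a type) and an explicit scalar multiplication. The free vector space on \<open>'x\<close> over \<open>'k\<close>
  is the type \<open>'x \<Rightarrow>\<^sub>0 'k\<close> of formal linear combinations.\<close>

definition fscale :: "'k::field \<Rightarrow> ('x \<Rightarrow>\<^sub>0 'k) \<Rightarrow> ('x \<Rightarrow>\<^sub>0 'k)" where
  "fscale c p = Poly_Mapping.map ((*) c) p"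

definition gen :: "'x \<Rightarrow> ('x \<Rightarrow>\<^sub>0 'k::field)" where
  "gen x = Poly_Mapping.single x 1"

definition lin_ext :: "('k::field \<Rightarrow> 'v::ab_group_add \<Rightarrow> 'v) \<Rightarrow> ('x \<Rightarrow> 'v) \<Rightarrow> ('x \<Rightarrow>\<^sub>0 'k) \<Rightarrow> 'v" where
  "lin_ext s f p = (\<Sum>x\<in>Poly_Mapping.keys p. s (Poly_Mapping.lookup p x) (f x))"

global_interpretation free: vector_space "fscale :: 'k::field \<Rightarrow> ('x \<Rightarrow>\<^sub>0 'k) \<Rightarrow> ('x \<Rightarrow>\<^sub>0 'k)"
proof -
  have l: "Poly_Mapping.lookup (fscale c p) x = c * Poly_Mapping.lookup p x"
    for c :: 'k and p :: "'x \<Rightarrow>\<^sub>0 'k" and x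
    by (simp add: fscale_def Poly_Mapping.map.rep_eq when_def)
  show "vector_space (fscale :: 'k \<Rightarrow> ('x \<Rightarrow>\<^sub>0 'k) \<Rightarrow> ('x \<Rightarrow>\<^sub>0 'k))"
    by unfold_locales
      (rule poly_mapping_eqI, simp add: l lookup_add algebra_simps)+
qed

text \<open>Elements of the quotient of a free vector space by a subspace \<open>U\<close> are cosets, so the quotient
  space itself is \<open>range (qcls U)\<close>. All operations on cosets are computed on a chosen representative.\<close>

definition qcls :: "('x \<Rightarrow>\<^sub>0 'k::field) set \<Rightarrow> ('x \<Rightarrow>\<^sub>0 'k) \<Rightarrow> ('x \<Rightarrow>\<^sub>0 'k) set" where
  "qcls U p = {q. q - p \<in> U}"

definition rep :: "('x \<Rightarrow>\<^sub>0 'k::field) set \<Rightarrow> ('x \<Rightarrow>\<^sub>0 'k)" where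
  "rep P = (SOME p. p \<in> P)"

definition qadd :: "('x \<Rightarrow>\<^sub>0 'k::field) set \<Rightarrow> ('x \<Rightarrow>\<^sub>0 'k) set \<Rightarrow> ('x \<Rightarrow>\<^sub>0 'k) set \<Rightarrow> ('x \<Rightarrow>\<^sub>0 'k) set" where
  "qadd U P Q = qcls U (rep P + rep Q)"

definition qscale :: "('x \<Rightarrow>\<^sub>0 'k::field) set \<Rightarrow> 'k \<Rightarrow> ('x \<Rightarrow>\<^sub>0 'k) set \<Rightarrow> ('x \<Rightarrow>\<^sub>0 'k) set" where
  "qscale U c P = qcls U (fscale c (rep P))"

text \<open>Linear maps from a vector space to a quotient space:\<close>

definition quot_linear ::
  "('k::field \<Rightarrow> 'v::ab_group_add \<Rightarrow> 'v) \<Rightarrow> ('x \<Rightarrow>\<^sub>0 'k) set \<Rightarrow> ('v \<Rightarrow> ('x \<Rightarrow>\<^sub>0 'k) set) \<Rightarrow> bool" where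
  "quot_linear s U f \<longleftrightarrow> (\<forall>v. f v \<in> range (qcls U)) \<and>
     (\<forall>v w. f (v + w) = qadd U (f v) (f w)) \<and> (\<forall>c v. f (s c v) = qscale U c (f v))"

text \<open>For \<open>P = \<Sum>\<^sub>i v\<^sub>i \<otimes> w\<^sub>i\<close> this is the Sweedler-style sum \<open>\<Sum>\<^sub>i f v\<^sub>i w\<^sub>i\<close>. It is independent of the
  chosen representation whenever \<open>f\<close> is bilinear (and balanced, if \<open>P\<close> lies in a balanced tensor
  product). If \<open>f\<close> takes values in a free vector space, the sum is only meant modulo relations,
  and a coset is formed at the end.\<close>

definition lift ::
  "('k::field \<Rightarrow> 'z::ab_group_add \<Rightarrow> 'z) \<Rightarrow> ('v \<Rightarrow> 'w \<Rightarrow> 'z) \<Rightarrow> ('v \<times> 'w \<Rightarrow>\<^sub>0 'k) set \<Rightarrow> 'z" where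
  "lift s f P = lin_ext s (\<lambda>(v, w). f v w) (rep P)"

definition bilin_rels ::
  "('k::field \<Rightarrow> 'v::ab_group_add \<Rightarrow> 'v) \<Rightarrow> ('k \<Rightarrow> 'w::ab_group_add \<Rightarrow> 'w) \<Rightarrow> ('v \<times> 'w \<Rightarrow>\<^sub>0 'k) set" where
  "bilin_rels sV sW =
     {gen (v + v', w) - gen (v, w) - gen (v', w) | v v' w. True} \<union>
     {gen (v, w + w') - gen (v, w) - gen (v, w') | v w w'. True} \<union>
     {gen (sV c v, w) - fscale c (gen (v, w)) | c v w. True} \<union>
     {gen (v, sW c w) - fscale c (gen (v, w)) | c v w. True}"

definition trilin_rels ::
  "('k::field \<Rightarrow> 'u::ab_group_add \<Rightarrow> 'u) \<Rightarrow> ('k \<Rightarrow> 'v::ab_group_add \<Rightarrow> 'v) \<Rightarrow>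
   ('k \<Rightarrow> 'w::ab_group_add \<Rightarrow> 'w) \<Rightarrow> ('u \<times> 'v \<times> 'w \<Rightarrow>\<^sub>0 'k) set" where
  "trilin_rels sU sV sW =
     {gen (u + u', v, w) - gen (u, v, w) - gen (u', v, w) | u u' v w. True} \<union>
     {gen (u, v + v', w) - gen (u, v, w) - gen (u, v', w) | u v v' w. True} \<union>
     {gen (u, v, w + w') - gen (u, v, w) - gen (u, v, w') | u v w w'. True} \<union>
     {gen (sU c u, v, w) - fscale c (gen (u, v, w)) | c u v w. True} \<union>
     {gen (u, sV c v, w) - fscale c (gen (u, v, w)) | c u v w. True} \<union>
     {gen (u, v, sW c w) - fscale c (gen (u, v, w)) | c u v w. True}"

definition tensor_rel where
  "tensor_rel sV sW = free.span (bilin_rels sV sW)"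

definition tensor3_rel where
  "tensor3_rel sU sV sW = free.span (trilin_rels sU sV sW)"

text \<open>\<open>V \<otimes> W\<close> and the class of a formal combination in it:\<close>

abbreviation tcls where "tcls sV sW \<equiv> qcls (tensor_rel sV sW)"
abbreviation tensor where "tensor sV sW \<equiv> range (tcls sV sW)"
abbreviation tcls3 where "tcls3 sU sV sW \<equiv> qcls (tensor3_rel sU sV sW)"

text \<open>The product \<open>(x \<otimes> y) (x' \<otimes> y') = m1 x x' \<otimes> m2 y y'\<close> on \<open>V \<otimes> W\<close> for bilinear products \<open>m1\<close>
  and \<open>m2\<close>:\<close>

definition tmult where
  "tmult sV sW m1 m2 P Q =
     tcls sV sW (lift fscale (\<lambda>x y. lift fscale (\<lambda>x' y'. gen (m1 x x', m2 y y')) Q) P)"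

text \<open>A bilinear map \<open>t : V \<times> W \<rightarrow> Z\<close> exhibiting a vector space \<open>Z\<close> as the tensor product \<open>V \<otimes> W\<close>:
  the induced map from the free vector space on \<open>V \<times> W\<close> to \<open>Z\<close> is surjective, with kernel
  the relations defining \<open>V \<otimes> W\<close>, i.e. it induces an isomorphism between \<open>V \<otimes> W\<close> and \<open>Z\<close>.
  (Bilinearity follows from this.)\<close>

definition is_tensor_product where
  "is_tensor_product sV sW sZ t \<longleftrightarrow>
     vector_space sV \<and> vector_space sW \<and> vector_space sZ \<and>
     surj (lin_ext sZ (\<lambda>(v, w). t v w)) \<and>
     {p. lin_ext sZ (\<lambda>(v, w). t v w) p = 0} = tensor_rel sV sW"

text \<open>The inverse isomorphism \<open>Z \<rightarrow> V \<otimes> W\<close>:\<close>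

definition as_tensor where
  "as_tensor sZ t z = {p. lin_ext sZ (\<lambda>(v, w). t v w) p = z}"


section \<open>Algebras, modules and Hopf algebras\<close>

text \<open>The class \<open>{ring, monoid_mult}\<close> is used for unital rings, since \<open>ring_1\<close> would exclude the
  zero ring.\<close>

locale k_algebra = vector_space s
  for s :: "'k::field \<Rightarrow> 'a::{ring,monoid_mult} \<Rightarrow> 'a" +
  assumes scale_mult_left: "s c x * y = s c (x * y)"
    and scale_mult_right: "x * s c y = s c (x * y)"

definition bilinear_map where
  "bilinear_map sV sW sZ f \<longleftrightarrow>
     (\<forall>w. Vector_Spaces.linear sV sZ (\<lambda>v. f v w)) \<and> (\<forall>v. Vector_Spaces.linear sW sZ (f v))"

definition algebra_hom where
  "algebra_hom sX sY f \<longleftrightarrow>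
     Vector_Spaces.linear sX sY f \<and> f 1 = 1 \<and> (\<forall>x y. f (x * y) = f x * f y)"

definition algebra_antihom where
  "algebra_antihom sX sY f \<longleftrightarrow>
     Vector_Spaces.linear sX sY f \<and> f 1 = 1 \<and> (\<forall>x y. f (x * y) = f y * f x)"

definition left_action where
  "left_action sX sV act \<longleftrightarrow>
     bilinear_map sX sV sV act \<and> (\<forall>v. act 1 v = v) \<and>
     (\<forall>x y v. act (x * y) v = act x (act y v))"

definition right_action where
  "right_action sX sV act \<longleftrightarrow>
     bilinear_map sV sX sV act \<and> (\<forall>v. act v 1 = v) \<and>
     (\<forall>x y v. act v (x * y) = act (act v x) y)"

locale hopf_algebra = k_algebra sT
  for sT :: "'k::field \<Rightarrow> 't::{ring,monoid_mult} \<Rightarrow> 't" +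
  fixes Dl :: "'t \<Rightarrow> ('t \<times> 't \<Rightarrow>\<^sub>0 'k) set"
    and ep :: "'t \<Rightarrow> 'k"
    and S :: "'t \<Rightarrow> 't"
  assumes comult_linear: "quot_linear sT (tensor_rel sT sT) Dl"
    and comult_one: "Dl 1 = tcls sT sT (gen (1, 1))"
    and comult_mult: "Dl (x * y) = tmult sT sT (*) (*) (Dl x) (Dl y)"
    and counit_hom: "algebra_hom sT (*) ep"
    and coassoc:
      "tcls3 sT sT sT (lift fscale (\<lambda>x y. lift fscale (\<lambda>x1 x2. gen (x1, x2, y)) (Dl x)) (Dl t)) =
       tcls3 sT sT sT (lift fscale (\<lambda>x y. lift fscale (\<lambda>y1 y2. gen (x, y1, y2)) (Dl y)) (Dl t))"
    and counit_left: "lift sT (\<lambda>x y. sT (ep x) y) (Dl t) = t"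
    and counit_right: "lift sT (\<lambda>x y. sT (ep y) x) (Dl t) = t"
    and antipode_linear: "Vector_Spaces.linear sT sT S"
    and antipode_left: "lift sT (\<lambda>x y. S x * y) (Dl t) = sT (ep t) 1"
    and antipode_right: "lift sT (\<lambda>x y. x * S y) (Dl t) = sT (ep t) 1"


section \<open>Yetter-Drinfeld module algebras and the scalar extension\<close>

text \<open>Left-right Yetter-Drinfeld module algebra with left action \<open>act\<close> and right coaction
  \<open>rho : A \<rightarrow> A \<otimes> T\<close>, the latter being an algebra morphism for the product of \<open>A \<otimes> T\<^sup>o\<^sup>p\<close>.\<close>

locale yetter_drinfeld_algebra =
  hopf_algebra sT Dl ep S + A: k_algebra sA
  for sT :: "'k::field \<Rightarrow> 't::{ring,monoid_mult} \<Rightarrow> 't" and Dl ep S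
    and sA :: "'k \<Rightarrow> 'a::{ring,monoid_mult} \<Rightarrow> 'a" +
  fixes act :: "'t \<Rightarrow> 'a \<Rightarrow> 'a"
    and rho :: "'a \<Rightarrow> ('a \<times> 't \<Rightarrow>\<^sub>0 'k) set"
  assumes action: "left_action sT sA act"
    and action_mult: "act t (a * b) = lift sA (\<lambda>t1 t2. act t1 a * act t2 b) (Dl t)"
    and action_one: "act t 1 = sA (ep t) 1"
    and coaction_linear: "quot_linear sA (tensor_rel sA sT) rho"
    and coaction_coassoc:
      "tcls3 sA sT sT (lift fscale (\<lambda>a0 a1. lift fscale (\<lambda>a00 a01. gen (a00, a01, a1)) (rho a0)) (rho a)) =
       tcls3 sA sT sT (lift fscale (\<lambda>a0 a1. lift fscale (\<lambda>t1 t2. gen (a0, t1, t2)) (Dl a1)) (rho a))"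
    and coaction_counit: "lift sA (\<lambda>a0 a1. sA (ep a1) a0) (rho a) = a"
    and coaction_one: "rho 1 = tcls sA sT (gen (1, 1))"
    and coaction_mult: "rho (a * b) = tmult sA sT (*) (\<lambda>t t'. t' * t) (rho a) (rho b)"
    and yetter_drinfeld:
      "tcls sA sT (lift fscale (\<lambda>t1 t2. lift fscale (\<lambda>a0 a1. gen (act t1 a0, t2 * a1)) (rho a)) (Dl t)) =
       tcls sA sT (lift fscale (\<lambda>t1 t2. lift fscale (\<lambda>b0 b1. gen (b0, b1 * t1)) (rho (act t2 a))) (Dl t))"

locale braided_commutative_yd_algebra = yetter_drinfeld_algebra +
  assumes braided_commutative: "lift sA (\<lambda>x0 x1. x0 * act x1 a) (rho x) = a * x"

text \<open>The smash product algebra: an algebra \<open>H\<close> with underlying vector space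
  \<open>A \<otimes> T\<close>, where \<open>sharp a t\<close> is the element \<open>a \<sharp> t\<close>. Its multiplication and unit are
  determined by the two equations below.\<close>

locale smash_product =
  k_algebra sH
  for sT :: "'k::field \<Rightarrow> 't::{ring,monoid_mult} \<Rightarrow> 't"
    and Dl :: "'t \<Rightarrow> ('t \<times> 't \<Rightarrow>\<^sub>0 'k) set"
    and sA :: "'k \<Rightarrow> 'a::{ring,monoid_mult} \<Rightarrow> 'a"
    and act :: "'t \<Rightarrow> 'a \<Rightarrow> 'a"
    and sH :: "'k \<Rightarrow> 'h::{ring,monoid_mult} \<Rightarrow> 'h" +
  fixes sharp :: "'a \<Rightarrow> 't \<Rightarrow> 'h"
  assumes tensor_product: "is_tensor_product sA sT sH sharp"
    and sharp_mult:
      "sharp a t * sharp a' t' = lift sH (\<lambda>t1 t2. sharp (a * act t1 a') (t2 * t')) (Dl t)"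
    and sharp_one: "sharp 1 1 = 1"

text \<open>\<open>H \<otimes>\<^sub>A H\<close> and \<open>H \<otimes>\<^sub>A H \<otimes>\<^sub>A H\<close> for an \<open>A\<close>-bimodule \<open>H\<close> with actions \<open>la\<close>, \<open>ra\<close>:\<close>

definition balanced_rel where
  "balanced_rel sH la ra = free.span (bilin_rels sH sH \<union>
     {gen (ra x a, y) - gen (x, la a y) | a x y. True})"

definition balanced3_rel where
  "balanced3_rel sH la ra = free.span (trilin_rels sH sH sH \<union>
     {gen (ra x a, y, z) - gen (x, la a y, z) | a x y z. True} \<union>
     {gen (x, ra y a, z) - gen (x, y, la a z) | a x y z. True})"

text \<open>The actions \<open>a . h . b = \<alpha>(a) \<beta>(b) h\<close>, the projection \<open>\<pi> : H \<otimes> H \<rightarrow> H \<otimes>\<^sub>A H\<close> and its kernel:\<close>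

definition lact :: "('a \<Rightarrow> 'h::{ring,monoid_mult}) \<Rightarrow> 'a \<Rightarrow> 'h \<Rightarrow> 'h" where
  "lact al a h = al a * h"

definition ract :: "('a \<Rightarrow> 'h::{ring,monoid_mult}) \<Rightarrow> 'h \<Rightarrow> 'a \<Rightarrow> 'h" where
  "ract be h b = be b * h"

abbreviation acls where
  "acls sH al be \<equiv> qcls (balanced_rel sH (lact al) (ract be))"

definition proj where
  "proj sH al be P = acls sH al be (rep P)"

definition kernel_proj where
  "kernel_proj sH al be = {P \<in> tensor sH sH. proj sH al be P = acls sH al be 0}"

text \<open>Structure maps of the scalar extension:\<close>

definition ext_alpha :: "('a \<Rightarrow> 't::{ring,monoid_mult} \<Rightarrow> 'h) \<Rightarrow> 'a \<Rightarrow> 'h" where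
  "ext_alpha sharp a = sharp a 1"

definition ext_beta where
  "ext_beta sH sharp rho a = lift sH sharp (rho a)"

definition ext_comult where
  "ext_comult sH sharp Dl rho h =
     acls sH (ext_alpha sharp) (ext_beta sH sharp rho)
       (lift fscale (\<lambda>a t. lift fscale (\<lambda>t1 t2. gen (sharp a t1, sharp 1 t2)) (Dl t)) (as_tensor sH sharp h))"

definition ext_counit where
  "ext_counit sA ep sH sharp h = lift sA (\<lambda>a t. sA (ep t) a) (as_tensor sH sharp h)"

definition ext_antipode where
  "ext_antipode sH sharp S rho h =
     lift sH (\<lambda>a t. sharp 1 (S t) * lift sH (\<lambda>a0 a1. sharp 1 (S (S a1)) * sharp a0 1) (rho a))
       (as_tensor sH sharp h)"


section \<open>Subalgebras of \<open>H \<otimes> H\<close> and their ideals\<close>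

definition tensor_subspace where
  "tensor_subspace sH B \<longleftrightarrow> B \<subseteq> tensor sH sH \<and> tcls sH sH 0 \<in> B \<and>
     (\<forall>P\<in>B. \<forall>Q\<in>B. qadd (tensor_rel sH sH) P Q \<in> B) \<and>
     (\<forall>c. \<forall>P\<in>B. qscale (tensor_rel sH sH) c P \<in> B)"

text \<open>not necessarily unital:\<close>

definition tensor_subalgebra where
  "tensor_subalgebra sH B \<longleftrightarrow> tensor_subspace sH B \<and>
     (\<forall>P\<in>B. \<forall>Q\<in>B. tmult sH sH (*) (*) P Q \<in> B)"

definition tensor_ideal where
  "tensor_ideal sH B J \<longleftrightarrow> tensor_subspace sH J \<and> J \<subseteq> B \<and>
     (\<forall>P\<in>B. \<forall>Q\<in>J. tmult sH sH (*) (*) P Q \<in> J \<and> tmult sH sH (*) (*) Q P \<in> J)"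

text \<open>The formal sum representing \<open>S a\<^sub>[\<^sub>1\<^sub>] \<otimes> a\<^sub>[\<^sub>0\<^sub>]\<close> in \<open>H \<otimes> H\<close>:\<close>

definition twist where
  "twist sharp S rho a = lift fscale (\<lambda>a0 a1. gen (sharp 1 (S a1), sharp a0 1)) (rho a)"

definition balancing where
  "balancing sH sharp Dl S rho = tensor_subalgebra sH hull
     ({tcls sH sH (gen (sharp a 1, 1)) | a. True} \<union>
      {tcls sH sH (twist sharp S rho a) | a. True} \<union>
      {tcls sH sH (lift fscale (\<lambda>t1 t2. gen (sharp 1 t1, sharp 1 t2)) (Dl t)) | t. True})"

definition balancing_plus where
  "balancing_plus sH sharp Dl S rho =
     tensor_ideal sH (balancing sH sharp Dl S rho) hull
       {tcls sH sH (gen (sharp a 1, 1) - twist sharp S rho a) | a. True}"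


section \<open>Bialgebroids and Hopf algebroids with a balancing subalgebra\<close>

locale enveloping_ring = A: k_algebra sA + H: k_algebra sH
  for sA :: "'k::field \<Rightarrow> 'a::{ring,monoid_mult} \<Rightarrow> 'a"
    and sH :: "'k \<Rightarrow> 'h::{ring,monoid_mult} \<Rightarrow> 'h" +
  fixes al be :: "'a \<Rightarrow> 'h"
  assumes source_hom: "algebra_hom sA sH al"
    and target_antihom: "algebra_antihom sA sH be"
    and images_commute: "al a * be b = be b * al a"

locale a_coring = A: k_algebra sA + H: vector_space sH
  for sA :: "'k::field \<Rightarrow> 'a::{ring,monoid_mult} \<Rightarrow> 'a"
    and sH :: "'k \<Rightarrow> 'h::ab_group_add \<Rightarrow> 'h" +
  fixes la :: "'a \<Rightarrow> 'h \<Rightarrow> 'h" and ra :: "'h \<Rightarrow> 'a \<Rightarrow> 'h"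
    and Dl :: "'h \<Rightarrow> ('h \<times> 'h \<Rightarrow>\<^sub>0 'k) set"
    and ep :: "'h \<Rightarrow> 'a"
  assumes left_mod: "left_action sA sH la"
    and right_mod: "right_action sA sH ra"
    and bimod: "ra (la a h) b = la a (ra h b)"
    and comult_linear: "quot_linear sH (balanced_rel sH la ra) Dl"
    and comult_bimod:
      "Dl (ra (la a h) b) =
         qcls (balanced_rel sH la ra) (lift fscale (\<lambda>x y. gen (la a x, ra y b)) (Dl h))"
    and coassoc:
      "qcls (balanced3_rel sH la ra) (lift fscale (\<lambda>x y. lift fscale (\<lambda>x1 x2. gen (x1, x2, y)) (Dl x)) (Dl h)) =
       qcls (balanced3_rel sH la ra) (lift fscale (\<lambda>x y. lift fscale (\<lambda>y1 y2. gen (x, y1, y2)) (Dl y)) (Dl h))"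
    and counit_linear: "Vector_Spaces.linear sH sA ep"
    and counit_bimod: "ep (ra (la a h) b) = a * ep h * b"
    and counit_left: "lift sH (\<lambda>x y. la (ep x) y) (Dl h) = h"
    and counit_right: "lift sH (\<lambda>x y. ra x (ep y)) (Dl h) = h"

text \<open>Condition (C1) is built in by using \<^const>\<open>lact\<close> and \<^const>\<open>ract\<close> as the actions of the
  coring. In (C3Mb), \<open>\<B>/(I\<^sub>A \<inter> \<B>)\<close> is identified with \<open>\<pi>(\<B>)\<close>, and products in it are
  computed on representatives in \<open>\<B>\<close>.\<close>

locale bialgebroid_balancing =
  enveloping_ring sA sH al be + a_coring sA sH "lact al" "ract be" Dl ep
  for sA :: "'k::field \<Rightarrow> 'a::{ring,monoid_mult} \<Rightarrow> 'a"
    and sH :: "'k \<Rightarrow> 'h::{ring,monoid_mult} \<Rightarrow> 'h"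
    and al be Dl ep +
  fixes B :: "('h \<times> 'h \<Rightarrow>\<^sub>0 'k) set set"
  assumes subalgebra: "tensor_subalgebra sH B"
    and C2: "left_action sH sA (\<lambda>h a. ep (h * al a))"
    and C3MI: "tensor_ideal sH B (kernel_proj sH al be \<inter> B)"
    and C3Ma: "range Dl \<subseteq> proj sH al be ` B"
    and C3Mb_one: "Dl 1 = acls sH al be (gen (1, 1))"
    and C3Mb_mult: "\<lbrakk>P \<in> B; Q \<in> B; proj sH al be P = Dl h; proj sH al be Q = Dl h'\<rbrakk> \<Longrightarrow>
      proj sH al be (tmult sH sH (*) (*) P Q) = Dl (h * h')"

locale hopf_algebroid_balancing =
  bialgebroid_balancing sA sH al be Dl ep B
  for sA :: "'k::field \<Rightarrow> 'a::{ring,monoid_mult} \<Rightarrow> 'a"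
    and sH :: "'k \<Rightarrow> 'h::{ring,monoid_mult} \<Rightarrow> 'h"
    and al be Dl ep B +
  fixes ta :: "'h \<Rightarrow> 'h"
  assumes antipode_antihom: "algebra_antihom sH sH ta"
    and antipode_kernel: "P \<in> kernel_proj sH al be \<inter> B \<Longrightarrow> lift sH (\<lambda>x y. x * ta y) P = 0"
    and antipode_target: "ta (be a) = al a"
    and antipode_right: "\<lbrakk>P \<in> B; proj sH al be P = Dl h\<rbrakk> \<Longrightarrow>
      lift sH (\<lambda>x y. x * ta y) P = al (ep h)"
    and antipode_left: "lift sH (\<lambda>x y. ta x * y) (Dl h) = be (ep (ta h))"

end

theory Submission
  imports Defs
begin

text \<open>
  Write \<open>I\<^sub>A\<close> for the kernel of \<open>H \<otimes> H \<rightarrow> H \<otimes>\<^sub>A H\<close> and \<open>\<phi>(x \<otimes> y) = x \<tau>(y)\<close>. The coproduct lifts to the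
  algebra homomorphism \<open>E(a \<sharp> t) = (a \<sharp> t\<^sub>1) \<otimes> (1 \<sharp> t\<^sub>2)\<close> from \<open>H\<close> to \<open>\<B>\<close>, and modulo \<open>\<B>\<^sup>+\<close> the generators
  \<open>S a\<^sub>[\<^sub>1\<^sub>] \<otimes> a\<^sub>[\<^sub>0\<^sub>]\<close> of \<open>\<B>\<close> become superfluous, so \<open>\<B> = E(H) + \<B>\<^sup>+\<close>. The generators of \<open>\<B>\<close> map \<open>I\<^sub>A\<close> into itself by
  left multiplication (for \<open>\<Delta>\<^sub>T(t)\<close> this is the Yetter-Drinfeld condition), and \<open>S a\<^sub>[\<^sub>1\<^sub>] \<otimes> a\<^sub>[\<^sub>0\<^sub>]\<close> acts on
  \<open>H \<otimes>\<^sub>A H\<close> like \<open>a \<otimes> 1\<close>. As \<open>\<tau>\<close> is an antihomomorphism and \<open>\<tau>(A)\<close> commutes with \<open>A\<close> (braided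
  commutativity), \<open>\<phi>\<close> maps \<open>\<B>\<close> into \<open>A\<close> and hence kills \<open>\<B>\<^sup>+\<close>; and an element \<open>E(h) + z\<close> of
  \<open>I\<^sub>A \<inter> \<B>\<close> has \<open>h = 0\<close> by the counit, so that \<open>\<phi>\<close> kills \<open>I\<^sub>A \<inter> \<B>\<close> too.
\<close>

section \<open>Linear maps and formal sums\<close>

text \<open>The obstacle is that \<phi> does not factor through H \<otimes>_A H: it sends \<beta>(a)
  \<otimes> 1 to \<beta>(a) but 1 \<otimes> \<alpha>(a) to \<tau>(\<alpha>(a)), and these need not
  coincide. Vanishing on the intersection of I_A with the balancing subalgebra B must therefore come
  from the structure of B. The two kernels also behave asymmetrically. I_A is a right ideal of H
  \<otimes> H and is stable on the left only under B, whereas \<phi>(p q) depends on q only through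
  \<phi>(q), so that the kernel of \<phi> is a left ideal. The set \<open>Z\<close> repairs this by
  asking for \<phi>(z q) = 0 for every q in B; this makes it two-sided in B, and hence E(H) +
  \<open>Z\<close> is closed under products. Identities of tensors are tested by multilinear maps
  into an arbitrary vector space. A Sweedler computation is then a chain of rewrites of
  \<open>lift\<close>, with linearity in each leg as side condition. Subsets of H \<otimes> H are
  replaced by their preimages among formal sums.\<close>

abbreviation lin :: "('k::field \<Rightarrow> 'v::ab_group_add \<Rightarrow> 'v) \<Rightarrow> ('k \<Rightarrow> 'w::ab_group_add \<Rightarrow> 'w) \<Rightarrow> ('v \<Rightarrow> 'w) \<Rightarrow> bool"
  where "lin \<equiv> Vector_Spaces.linear"

text \<open>Sweedler rewrites ask for linearity in each leg. These rules, mostly kept in composed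
  form, reduce such goals to the basic maps.\<close>

named_theorems lin_intros

lemma linI:
  assumes "vector_space s1" "vector_space s2"
    and "\<And>x y. f (x + y) = f x + f y" and "\<And>c x. f (s1 c x) = s2 c (f x)"
  shows "lin s1 s2 f"
  using assms
  by (intro Vector_Spaces.linear.intro module_hom.intro module_hom_axioms.intro)
    (simp_all add: module_iff_vector_space)

lemma lin_vs1: "lin s1 s2 f \<Longrightarrow> vector_space s1"
  and lin_vs2: "lin s1 s2 f \<Longrightarrow> vector_space s2"
  by (simp_all add: Vector_Spaces.linear_def)

lemma lin_add: "lin s1 s2 f \<Longrightarrow> f (x + y) = f x + f y"
  and lin_scale: "lin s1 s2 f \<Longrightarrow> f (s1 c x) = s2 c (f x)"
  and lin_zero: "lin s1 s2 f \<Longrightarrow> f 0 = 0"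
  and lin_diff: "lin s1 s2 f \<Longrightarrow> f (x - y) = f x - f y"
  and lin_sum: "lin s1 s2 f \<Longrightarrow> f (sum g F) = (\<Sum>x\<in>F. f (g x))"
  by (simp_all add: linear_iff_module_hom module_hom.add module_hom.scale module_hom.zero
      module_hom.diff module_hom.sum)

lemma lin_id [lin_intros]: "vector_space s \<Longrightarrow> lin s s (\<lambda>x. x)"
  by (rule linI) auto

lemma lin_comp: "lin s1 s2 g \<Longrightarrow> lin s0 s1 f \<Longrightarrow> lin s0 s2 (\<lambda>x. g (f x))"
  by (rule linI[OF lin_vs1[of s0 s1 f] lin_vs2[of s1 s2 g]])
    (simp_all add: lin_add[of s1 s2 g] lin_add[of s0 s1 f] lin_scale[of s1 s2 g] lin_scale[of s0 s1 f])

lemma vs_simps: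
  assumes "vector_space s"
  shows "s c (x + y) = s c x + s c y" "s c (x - y) = s c x - s c y" "s c 0 = 0"
    "s (a + b) x = s a x + s b x" "s 0 x = 0" "s 1 x = x" "s a (s b x) = s (a * b) x"
proof -
  interpret vector_space s by fact
  show "s c (x + y) = s c x + s c y" "s c (x - y) = s c x - s c y" "s c 0 = 0"
    "s (a + b) x = s a x + s b x" "s 0 x = 0" "s 1 x = x" "s a (s b x) = s (a * b) x"
    by (simp_all add: scale_right_distrib scale_right_diff_distrib scale_left_distrib)
qed

lemma lin_scale_right [lin_intros]:
  assumes f: "lin s1 s2 f" shows "lin s1 s2 (\<lambda>x. s2 c (f x))"
  by (rule linI[OF lin_vs1[OF f] lin_vs2[OF f]])
    (simp_all add: lin_add[OF f] lin_scale[OF f] vs_simps[OF lin_vs2[OF f]] mult.commute)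

lemma lin_scale_left [lin_intros]:
  assumes "vector_space s2" "lin s1 (*) f"
  shows "lin s1 s2 (\<lambda>x. s2 (f x) v)"
  using assms(2) by (intro linI lin_vs1[OF assms(2)] assms(1))
    (simp_all add: lin_add[OF assms(2)] lin_scale[OF assms(2)] vs_simps[OF assms(1)])

text \<open>A basis of \<open>U\<close> is extended to a basis of the whole space; \<open>p\<close>
  kills the former and fixes the added vectors.\<close>

lemma subspace_projection:
  assumes "vector_space s" "module.subspace s U"
  obtains p where "lin s s p" "\<And>x. p x = 0 \<longleftrightarrow> x \<in> U"
proof -
  interpret vector_space s by fact
  interpret P: vector_space_pair s s by unfold_locales
  obtain B where B: "B \<subseteq> U" "independent B" "U \<subseteq> span B"
    using maximal_independent_subset by blast
  have UB: "U = span B"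
    using B span_minimal[OF B(1) assms(2)] by blast
  define C where "C = extend_basis B"
  have C: "B \<subseteq> C" "independent C" "span C = UNIV"
    using B(2) by (auto simp: C_def extend_basis_superset independent_extend_basis)
  obtain p where p: "lin s s p" "\<forall>x\<in>C. p x = (if x \<in> B then 0 else x)"
    using P.linear_independent_extend[OF C(2), of "\<lambda>x. if x \<in> B then 0 else x"] by blast
  have 1: "p x = 0" if "x \<in> span B" for x
    using that
  proof (induction rule: span_induct_alt)
    case base
    show ?case using lin_zero[OF p(1)] .
  next
    case (step c b y)
    then show ?case using p(2) C(1) by (auto simp: lin_add[OF p(1)] lin_scale[OF p(1)])
  qed
  have 2: "p x = x" if "x \<in> span (C - B)" for x
    using that
  proof (induction rule: span_induct_alt)
    case base
    show ?case using lin_zero[OF p(1)] .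
  next
    case (step c b y)
    then show ?case using p(2) by (auto simp: lin_add[OF p(1)] lin_scale[OF p(1)])
  qed
  have 3: "x \<in> U" if "p x = 0" for x
  proof -
    have "x \<in> span (B \<union> (C - B))" using C by (simp add: Un_absorb1)
    then obtain u w where uw: "x = u + w" "u \<in> span B" "w \<in> span (C - B)"
      unfolding span_Un by blast
    then have "w = 0" using that 1 2 by (simp add: lin_add[OF p(1)])
    then show ?thesis using uw UB by simp
  qed
  show ?thesis
    by (rule that[OF p(1)]) (use 1 3 UB in blast)
qed

section \<open>Linear extension from generators\<close>

lemma lookup_fscale: "Poly_Mapping.lookup (fscale c p) x = c * Poly_Mapping.lookup p x"
  by (simp add: fscale_def Poly_Mapping.map.rep_eq when_def)

lemma lin_ext_superset:
  assumes "vector_space s" "finite F" "Poly_Mapping.keys p \<subseteq> F"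
  shows "lin_ext s f p = (\<Sum>x\<in>F. s (Poly_Mapping.lookup p x) (f x))"
  unfolding lin_ext_def
  by (rule sum.mono_neutral_left)
     (use assms in \<open>auto simp: vs_simps[OF assms(1)] in_keys_iff\<close>)

lemma lin_lin_ext: assumes "vector_space s" shows "lin fscale s (lin_ext s f)"
proof (rule linI)
  show "vector_space (fscale :: 'a \<Rightarrow> ('c \<Rightarrow>\<^sub>0 'a) \<Rightarrow> _)" by (rule free.vector_space_axioms)
  show "vector_space s" by fact
  show "lin_ext s f (p + q) = lin_ext s f p + lin_ext s f q" for p q
  proof -
    \<comment> \<open>Terms may cancel in \<open>p + q\<close>, so all three sums are taken over a
      common index set.\<close>
    let ?F = "Poly_Mapping.keys p \<union> Poly_Mapping.keys q"
    have "Poly_Mapping.keys (p + q) \<subseteq> ?F" by (rule Poly_Mapping.keys_add)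
    then show ?thesis
      by (simp add: lin_ext_superset[OF assms, of ?F] lookup_add vs_simps[OF assms] sum.distrib)
  qed
  show "lin_ext s f (fscale c p) = s c (lin_ext s f p)" for c p
  proof -
    interpret vector_space s by fact
    have "Poly_Mapping.keys (fscale c p) \<subseteq> Poly_Mapping.keys p"
      by (auto simp: in_keys_iff lookup_fscale)
    then show ?thesis
      by (simp add: lin_ext_superset[OF assms, of "Poly_Mapping.keys p"] lookup_fscale
          scale_sum_right)
  qed
qed

lemma lin_ext_gen: "vector_space s \<Longrightarrow> lin_ext s f (gen x) = f x"
  by (simp add: lin_ext_def gen_def vs_simps(6))

lemma gen_expansion: "lin_ext fscale gen p = p"
proof (rule poly_mapping_eqI)
  fix x
  have "Poly_Mapping.lookup (lin_ext fscale gen p) x =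
    (\<Sum>y\<in>Poly_Mapping.keys p. Poly_Mapping.lookup p y * (1 when y = x))"
    by (simp add: lin_ext_def Poly_Mapping.lookup_sum lookup_fscale gen_def lookup_single)
  also have "\<dots> = Poly_Mapping.lookup p x"
    by (simp add: when_def in_keys_iff if_distrib cong: if_cong)
  finally show "Poly_Mapping.lookup (lin_ext fscale gen p) x = Poly_Mapping.lookup p x" .
qed

lemma lin_ext_commute: "lin s1 s2 g \<Longrightarrow> g (lin_ext s1 f p) = lin_ext s2 (\<lambda>x. g (f x)) p"
  by (simp add: lin_ext_def lin_sum[of s1 s2 g] lin_scale[of s1 s2 g])

lemma lin_free_eq: "lin fscale s g \<Longrightarrow> g p = lin_ext s (\<lambda>x. g (gen x)) p"
  by (metis gen_expansion lin_ext_commute)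

lemma lin_free_cong:
  assumes "lin fscale s f" "lin fscale s g" "\<And>x. f (gen x) = g (gen x)"
  shows "f p = g p"
  using lin_free_eq[OF assms(1), of p] lin_free_eq[OF assms(2), of p] assms(3) by simp

lemma lin_ext_fun [lin_intros]:
  assumes "vector_space s1" "vector_space s2" "\<And>x. lin s1 s2 (\<lambda>v. f v x)"
  shows "lin s1 s2 (\<lambda>v. lin_ext s2 (f v) p)"
proof -
  interpret vector_space s2 by fact
  show ?thesis
    by (rule linI[OF assms(1,2)])
     (simp_all add: lin_ext_def lin_add[OF assms(3)] lin_scale[OF assms(3)] scale_right_distrib
        sum.distrib scale_sum_right mult.commute)
qed

lemma lin_ext_swap:
  assumes "vector_space s"
  shows "lin_ext s (\<lambda>x. lin_ext s (f x) q) p = lin_ext s (\<lambda>y. lin_ext s (\<lambda>x. f x y) p) q"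
proof -
  interpret vector_space s by fact
  show ?thesis
    unfolding lin_ext_def scale_sum_right
    by (subst sum.swap) (simp add: mult.commute)
qed

section \<open>Cosets and tensors\<close>

lemma qcls_self: "free.subspace U \<Longrightarrow> p \<in> qcls U p"
  by (simp add: qcls_def free.subspace_0)

lemma qcls_eq_iff:
  assumes "free.subspace U" shows "qcls U p = qcls U q \<longleftrightarrow> p - q \<in> U"
proof
  assume "qcls U p = qcls U q"
  then show "p - q \<in> U" using qcls_self[OF assms, of p] by (simp add: qcls_def)
next
  assume pq: "p - q \<in> U"
  have "x - p \<in> U \<longleftrightarrow> x - q \<in> U" for x
    using free.subspace_add[OF assms pq, of "x - p"] free.subspace_diff[OF assms _ pq, of "x - q"]
    by auto
  then show "qcls U p = qcls U q" by (auto simp: qcls_def)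
qed

lemma rep_qcls: assumes "free.subspace U" shows "rep (qcls U p) - p \<in> U"
proof -
  have "rep (qcls U p) \<in> qcls U p"
    unfolding rep_def by (rule someI, rule qcls_self[OF assms])
  then show ?thesis by (simp add: qcls_def)
qed

lemma qadd_qcls:
  assumes "free.subspace U" shows "qadd U (qcls U p) (qcls U q) = qcls U (p + q)"
  using free.subspace_add[OF assms rep_qcls[OF assms, of p] rep_qcls[OF assms, of q]]
  by (simp add: qadd_def qcls_eq_iff[OF assms] algebra_simps)

lemma qscale_qcls:
  assumes "free.subspace U" shows "qscale U c (qcls U p) = qcls U (fscale c p)"
  using free.subspace_scale[OF assms rep_qcls[OF assms, of p], of c]
  by (simp add: qscale_def qcls_eq_iff[OF assms] free.scale_right_diff_distrib)

text \<open>The quotients by \<open>U\<close> are not types, so they cannot be targets of linear maps. An arbitrary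
  linear endomorphism \<open>qpr U\<close> with kernel \<open>U\<close> replaces the quotient map instead: congruences modulo
  \<open>U\<close> become equations after applying it.\<close>

definition qpr :: "('x \<Rightarrow>\<^sub>0 'k::field) set \<Rightarrow> ('x \<Rightarrow>\<^sub>0 'k) \<Rightarrow> ('x \<Rightarrow>\<^sub>0 'k)" where
  "qpr U = (SOME \<pi>. lin fscale fscale \<pi> \<and> (\<forall>p. \<pi> p = 0 \<longleftrightarrow> p \<in> U))"

lemma
  fixes U :: "('x \<Rightarrow>\<^sub>0 'k::field) set"
  assumes "free.subspace U"
  shows lin_qpr: "lin fscale fscale (qpr U)" and qpr_eq_0: "qpr U p = 0 \<longleftrightarrow> p \<in> U"
proof -
  have "\<exists>\<pi> :: ('x \<Rightarrow>\<^sub>0 'k) \<Rightarrow> ('x \<Rightarrow>\<^sub>0 'k). lin fscale fscale \<pi> \<and> (\<forall>p. \<pi> p = 0 \<longleftrightarrow> p \<in> U)"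
    by (rule subspace_projection[OF free.vector_space_axioms assms]) blast
  from someI_ex[OF this] show "lin fscale fscale (qpr U)" "qpr U p = 0 \<longleftrightarrow> p \<in> U"
    unfolding qpr_def by blast+
qed

lemma qpr_eq_iff: "free.subspace U \<Longrightarrow> qpr U p = qpr U q \<longleftrightarrow> p - q \<in> U"
  using qpr_eq_0[of U "p - q"] by (simp add: lin_diff[OF lin_qpr])

lemma qcls_eq_qpr: "free.subspace U \<Longrightarrow> qcls U p = qcls U q \<longleftrightarrow> qpr U p = qpr U q"
  by (simp add: qcls_eq_iff qpr_eq_iff)

lemma quot_linearI:
  assumes "free.subspace U" "vector_space s"
    "\<And>v w. f (v + w) - (f v + f w) \<in> U" "\<And>c v. f (s c v) - fscale c (f v) \<in> U"
  shows "quot_linear s U (\<lambda>v. qcls U (f v))"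
  unfolding quot_linear_def using assms by (auto simp: qadd_qcls qscale_qcls qcls_eq_iff)

lemma lin_ext_span_zero:
  assumes "vector_space s" "\<And>r. r \<in> R \<Longrightarrow> lin_ext s f r = 0" "p \<in> free.span R"
  shows "lin_ext s f p = 0"
  using assms(3)
proof (induction rule: free.span_induct_alt)
  case base
  show ?case using lin_zero[OF lin_lin_ext[OF assms(1)]] .
next
  case (step c b y)
  then show ?case
    by (simp add: lin_add[OF lin_lin_ext[OF assms(1)]] lin_scale[OF lin_lin_ext[OF assms(1)]]
        assms(2) vs_simps[OF assms(1)])
qed

text \<open>Vanishing on \<open>U\<close> removes the dependence on the representative picked by
  \<open>rep\<close>.\<close>

lemma lift_eq:
  assumes "vector_space s" "free.subspace U" "\<And>p. p \<in> U \<Longrightarrow> lin_ext s (\<lambda>(v, w). f v w) p = 0"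
  shows "lift s f (qcls U p) = lin_ext s (\<lambda>(v, w). f v w) p"
proof -
  have "lin_ext s (\<lambda>(v, w). f v w) (rep (qcls U p) - p) = 0"
    using assms(3) rep_qcls[OF assms(2)] by blast
  then show ?thesis
    by (simp add: lin_diff[OF lin_lin_ext[OF assms(1)]] lift_def)
qed

lemmas lin_ext_expand = lin_diff[OF lin_lin_ext] lin_add[OF lin_lin_ext] lin_scale[OF lin_lin_ext]
  lin_ext_gen

lemma bilin_ext_zero:
  assumes "\<And>w. lin sV s (\<lambda>v. f v w)" "\<And>v. lin sW s (f v)" "p \<in> tensor_rel sV sW"
  shows "lin_ext s (\<lambda>(v, w). f v w) p = 0"
proof -
  have vs: "vector_space s" by (rule lin_vs2[OF assms(1)])
  show ?thesis
    using assms(3) unfolding tensor_rel_def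
    by (rule lin_ext_span_zero[OF vs, rotated])
      (auto simp: bilin_rels_def lin_ext_expand[OF vs] lin_add[OF assms(1)] lin_add[OF assms(2)]
        lin_scale[OF assms(1)] lin_scale[OF assms(2)])
qed

lemma trilin_ext_zero:
  assumes "\<And>v w. lin sU s (\<lambda>u. f u v w)" "\<And>u w. lin sV s (\<lambda>v. f u v w)" "\<And>u v. lin sW s (f u v)"
    and "p \<in> tensor3_rel sU sV sW"
  shows "lin_ext s (\<lambda>(u, v, w). f u v w) p = 0"
proof -
  have vs: "vector_space s" by (rule lin_vs2[OF assms(1)])
  show ?thesis
    using assms(4) unfolding tensor3_rel_def
    by (rule lin_ext_span_zero[OF vs, rotated])
      (auto simp: trilin_rels_def lin_ext_expand[OF vs] lin_add[OF assms(1)] lin_add[OF assms(2)]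
        lin_add[OF assms(3)] lin_scale[OF assms(1)] lin_scale[OF assms(2)] lin_scale[OF assms(3)])
qed

lemma subspace_tensor_rel: "free.subspace (tensor_rel sV sW)"
  and subspace_tensor3_rel: "free.subspace (tensor3_rel sU sV sW)"
  and subspace_balanced_rel: "free.subspace (balanced_rel sH la ra)"
  and subspace_balanced3_rel: "free.subspace (balanced3_rel sH la ra)"
  by (simp_all add: tensor_rel_def tensor3_rel_def balanced_rel_def balanced3_rel_def)

lemma lift_tcls:
  assumes "\<And>w. lin sV s (\<lambda>v. f v w)" "\<And>v. lin sW s (f v)"
  shows "lift s f (tcls sV sW p) = lin_ext s (\<lambda>(v, w). f v w) p"
  by (rule lift_eq[OF lin_vs2[OF assms(2)] subspace_tensor_rel bilin_ext_zero[OF assms]])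

text \<open>The following facts need no multilinearity, since both sides use the same
  representatives.\<close>

lemma lift_commute: "lin s1 s2 g \<Longrightarrow> g (lift s1 f P) = lift s2 (\<lambda>x y. g (f x y)) P"
  by (simp add: lift_def lin_ext_commute case_prod_unfold)

lemma lift_swap:
  "vector_space s \<Longrightarrow>
   lift s (\<lambda>x y. lift s (\<lambda>u v. f x y u v) Q) P = lift s (\<lambda>u v. lift s (\<lambda>x y. f x y u v) P) Q"
  unfolding lift_def case_prod_unfold by (rule lin_ext_swap)

lemma lin_lift [lin_intros]:
  "vector_space s1 \<Longrightarrow> vector_space s2 \<Longrightarrow> (\<And>x y. lin s1 s2 (\<lambda>v. f v x y)) \<Longrightarrow>
   lin s1 s2 (\<lambda>v. lift s2 (f v) P)"
  unfolding lift_def case_prod_unfold by (rule lin_ext_fun)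

lemma lin_ext_lift:
  assumes "vector_space s"
  shows "lin_ext s g (lift fscale f P) = lift s (\<lambda>x y. lin_ext s g (f x y)) P"
  by (rule lift_commute[OF lin_lin_ext[OF assms]])

text \<open>The representatives of \<open>D (v + w)\<close> and of \<open>D v\<close>,
  \<open>D w\<close> match only modulo \<open>U\<close>, so additivity needs a map that vanishes on
  \<open>U\<close>.\<close>

lemma lin_lift_quot_linear:
  assumes "quot_linear s1 U D" "vector_space s1" "vector_space s2" "free.subspace U"
    and "\<And>p. p \<in> U \<Longrightarrow> lin_ext s2 (\<lambda>(v, w). f v w) p = 0"
  shows "lin s1 s2 (\<lambda>v. lift s2 f (D v))"
proof -
  have *: "lift s2 f (qcls U p) = lin_ext s2 (\<lambda>(v, w). f v w) p" for p
    using lift_eq[OF assms(3,4,5)] by blast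
  have r: "\<exists>p. D v = qcls U p" for v
    using assms(1) unfolding quot_linear_def by blast
  show ?thesis
  proof (rule linI[OF assms(2,3)])
    fix v w c
    obtain p q where pq: "D v = qcls U p" "D w = qcls U q" using r by metis
    show "lift s2 f (D (v + w)) = lift s2 f (D v) + lift s2 f (D w)"
      using assms(1) pq by (simp add: quot_linear_def qadd_qcls[OF assms(4)] * lin_ext_expand[OF assms(3)])
    show "lift s2 f (D (s1 c v)) = s2 c (lift s2 f (D v))"
      using assms(1) pq by (simp add: quot_linear_def qscale_qcls[OF assms(4)] * lin_ext_expand[OF assms(3)])
  qed
qed

lemma lift_tmult:
  assumes "\<And>w. lin sV s (\<lambda>v. f v w)" "\<And>v. lin sW s (f v)"
  shows "lift s f (tmult sV sW m1 m2 P Q) =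
    lift s (\<lambda>x y. lift s (\<lambda>x' y'. f (m1 x x') (m2 y y')) Q) P"
proof -
  have vs: "vector_space s" by (rule lin_vs2[OF assms(1)])
  show ?thesis
    unfolding tmult_def lift_tcls[OF assms]
    by (simp add: lin_ext_lift[OF vs] lin_ext_gen[OF vs])
qed

lemma lift_cong_tcls3:
  assumes "\<And>v w. lin sU s (\<lambda>u. f u v w)" "\<And>u w. lin sV s (\<lambda>v. f u v w)" "\<And>u v. lin sW s (f u v)"
    and "tcls3 sU sV sW p = tcls3 sU sV sW q"
  shows "lin_ext s (\<lambda>(u, v, w). f u v w) p = lin_ext s (\<lambda>(u, v, w). f u v w) q"
proof -
  have vs: "vector_space s" by (rule lin_vs2[OF assms(1)])
  have "lin_ext s (\<lambda>(u, v, w). f u v w) (p - q) = 0"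
    using assms(4) by (intro trilin_ext_zero[OF assms(1-3)]) (simp_all add: qcls_eq_iff[OF subspace_tensor3_rel])
  then show ?thesis by (simp add: lin_ext_expand[OF vs])
qed

section \<open>Sweedler calculus in a Hopf algebra\<close>

context k_algebra
begin

lemma vector_space_scale [lin_intros]: "vector_space s"
  by (rule vector_space_axioms)

lemma lin_mult_left [lin_intros]: "lin s0 s f \<Longrightarrow> lin s0 s (\<lambda>x. f x * c)"
  by (rule linI[OF lin_vs1[of s0 s f] vector_space_axioms])
    (simp_all add: lin_add[of s0 s f] lin_scale[of s0 s f] distrib_right scale_mult_left)

lemma lin_mult_right [lin_intros]: "lin s0 s f \<Longrightarrow> lin s0 s (\<lambda>x. c * f x)"
  by (rule linI[OF lin_vs1[of s0 s f] vector_space_axioms])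
    (simp_all add: lin_add[of s0 s f] lin_scale[of s0 s f] distrib_left scale_mult_right)

end

lemmas vector_space_fscale [lin_intros] = free.vector_space_axioms

context hopf_algebra
begin

abbreviation sw :: "('k \<Rightarrow> 'z::ab_group_add \<Rightarrow> 'z) \<Rightarrow> 't \<Rightarrow> ('t \<Rightarrow> 't \<Rightarrow> 'z) \<Rightarrow> 'z" where
  "sw s t f \<equiv> lift s f (Dl t)"

text \<open>The inner map \<open>F\<close> lets the rule reach nested Sweedler sums, where the
  comultiplied element itself varies with an outer leg.\<close>

lemma lin_sw [lin_intros]:
  assumes "lin s0 sT F" "\<And>y. lin sT s (\<lambda>x. f x y)" "\<And>x. lin sT s (f x)"
  shows "lin s0 s (\<lambda>v. sw s (F v) f)"
  by (rule lin_comp[OF lin_lift_quot_linear[OF comult_linear vector_space_axioms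
          lin_vs2[OF assms(3)] subspace_tensor_rel bilin_ext_zero[OF assms(2,3)]] assms(1)])

lemma lin_counit: "lin sT (*) ep"
  and counit_one: "ep 1 = 1"
  and counit_mult: "ep (x * y) = ep x * ep y"
  using counit_hom by (simp_all add: algebra_hom_def)

lemmas lin_counit_comp [lin_intros] = lin_comp[OF lin_counit]
lemmas lin_antipode_comp [lin_intros] = lin_comp[OF antipode_linear]

lemma sw_one:
  assumes "\<And>y. lin sT s (\<lambda>x. f x y)" "\<And>x. lin sT s (f x)"
  shows "sw s 1 f = f 1 1"
  by (simp add: comult_one lift_tcls[OF assms] lin_ext_gen[OF lin_vs2[OF assms(2)]])

lemma sw_mult:
  assumes "\<And>y. lin sT s (\<lambda>x. f x y)" "\<And>x. lin sT s (f x)"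
  shows "sw s (x * y) f = sw s x (\<lambda>x1 x2. sw s y (\<lambda>y1 y2. f (x1 * y1) (x2 * y2)))"
  by (simp add: comult_mult lift_tmult[OF assms])

lemma sw_coassoc:
  assumes "\<And>v w. lin sT s (\<lambda>u. f u v w)" "\<And>u w. lin sT s (\<lambda>v. f u v w)" "\<And>u v. lin sT s (f u v)"
  shows "sw s t (\<lambda>x y. sw s x (\<lambda>x1 x2. f x1 x2 y)) = sw s t (\<lambda>x y. sw s y (\<lambda>y1 y2. f x y1 y2))"
  using lift_cong_tcls3[OF assms coassoc[of t]]
  by (simp add: lin_ext_lift[OF lin_vs2[OF assms(3)]] lin_ext_gen[OF lin_vs2[OF assms(3)]])

lemma sw_counit_left: "lin sT s g \<Longrightarrow> sw s t (\<lambda>x y. s (ep x) (g y)) = g t"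
  using lift_commute[of sT s g "\<lambda>x y. sT (ep x) y" "Dl t"]
  by (simp add: counit_left lin_scale[of sT s g])

lemma sw_counit_right: "lin sT s g \<Longrightarrow> sw s t (\<lambda>x y. s (ep y) (g x)) = g t"
  using lift_commute[of sT s g "\<lambda>x y. sT (ep y) x" "Dl t"]
  by (simp add: counit_right lin_scale[of sT s g])

lemma sw_antipode_left: "lin sT s g \<Longrightarrow> sw s t (\<lambda>x y. g (S x * y)) = s (ep t) (g 1)"
  using lift_commute[of sT s g "\<lambda>x y. S x * y" "Dl t"]
  by (simp add: antipode_left lin_scale[of sT s g])

lemma sw_antipode_right: "lin sT s g \<Longrightarrow> sw s t (\<lambda>x y. g (x * S y)) = s (ep t) (g 1)"
  using lift_commute[of sT s g "\<lambda>x y. x * S y" "Dl t"]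
  by (simp add: antipode_right lin_scale[of sT s g])

text \<open>The pattern of most antipode cancellations: the inner sum leaves a counit of the second
  leg, which the counit axiom absorbs.\<close>

lemma sw_collapse_right:
  assumes "lin sT s k" "\<And>x y. sw s y (h x) = s (ep y) (k x)"
  shows "sw s t (\<lambda>x y. sw s y (h x)) = k t"
  by (simp add: assms(2) sw_counit_right[OF assms(1)])

text \<open>The same pattern when the first two legs cancel; coassociativity regroups them
  first.\<close>

lemma sw_collapse_left:
  assumes "\<And>v w. lin sT s (\<lambda>u. h u v w)" "\<And>u w. lin sT s (\<lambda>v. h u v w)" "\<And>u v. lin sT s (h u v)"
    and "lin sT s k" "\<And>x y. sw s x (\<lambda>x1 x2. h x1 x2 y) = s (ep x) (k y)"
  shows "sw s t (\<lambda>x y. sw s y (h x)) = k t"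
  using sw_coassoc[OF assms(1-3), of t] by (simp add: assms(5) sw_counit_left[OF assms(4)])

section \<open>The antipode of T reverses products and coproducts\<close>

lemma antipode_one: "S 1 = 1"
  using antipode_left[of 1]
  by (subst (asm) sw_one) (auto intro!: lin_intros simp: counit_one vs_simps(6)[OF vector_space_axioms])

text \<open>Uniqueness of convolution inverses: S(xy) and S(y) S(x) both invert the multiplication T
  \<otimes> T \<rightarrow> T. \<open>E\<close> is the triple convolution product S(x1 y1) x2 y2
  S(y3) S(x3), evaluated in both groupings.\<close>

lemma antipode_mult: "S (x * y) = S y * S x"
proof -
  define E where "E = sw sT x (\<lambda>x1 x'. sw sT x' (\<lambda>x2 x3. sw sT y (\<lambda>y1 y'. sw sT y' (\<lambda>y2 y3.
    S (x1 * y1) * (x2 * y2) * (S y3 * S x3)))))"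
  have "sw sT y (\<lambda>y1 y'. sw sT y' (\<lambda>y2 y3. S (x1 * y1) * (x2 * y2) * (S y3 * S x3))) =
      S (x1 * y) * (x2 * S x3)" for x1 x2 x3
  proof (rule sw_collapse_right[where k = "\<lambda>y. S (x1 * y) * (x2 * S x3)"])
    show "lin sT sT (\<lambda>y. S (x1 * y) * (x2 * S x3))" by (intro lin_intros)
    fix y1 y'
    show "sw sT y' (\<lambda>y2 y3. S (x1 * y1) * (x2 * y2) * (S y3 * S x3)) =
        sT (ep y') (S (x1 * y1) * (x2 * S x3))"
      using sw_antipode_right[of sT "\<lambda>z. S (x1 * y1) * x2 * z * S x3" y']
      by (simp add: mult.assoc lin_intros)
  qed
  then have "E = sw sT x (\<lambda>x1 x'. sw sT x' (\<lambda>x2 x3. S (x1 * y) * (x2 * S x3)))"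
    by (simp add: E_def)
  also have "\<dots> = S (x * y)"
    using sw_antipode_right[of sT "\<lambda>z. S (x1 * y) * z" for x1]
    by (intro sw_collapse_right[where k = "\<lambda>x. S (x * y)"]) (simp_all add: lin_intros)
  finally have 1: "E = S (x * y)" .
  \<comment> \<open>In the other grouping, x1 y1 and x2 y2 are the two legs of a single product, so
    S(u) v collapses.\<close>
  have "E = S y * S x"
    unfolding E_def
  proof (rule sw_collapse_left[where k = "\<lambda>x. S y * S x"], goal_cases)
    case (5 x x3)
    have "sw sT x (\<lambda>x1 x2. sw sT y (\<lambda>y1 y'. sw sT y' (\<lambda>y2 y3. S (x1 * y1) * (x2 * y2) * (S y3 * S x3)))) =
        sw sT x (\<lambda>x1 x2. sw sT y (\<lambda>y' y3. sw sT y' (\<lambda>y1 y2. S (x1 * y1) * (x2 * y2) * (S y3 * S x3))))"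
      by (subst sw_coassoc) (intro lin_intros | rule refl)+
    also have "\<dots> = sw sT y (\<lambda>y' y3. sw sT x (\<lambda>x1 x2. sw sT y' (\<lambda>y1 y2. S (x1 * y1) * (x2 * y2) * (S y3 * S x3))))"
      by (rule lift_swap[OF vector_space_axioms])
    also have "\<dots> = sw sT y (\<lambda>y' y3. sw sT (x * y') (\<lambda>u v. S u * v * (S y3 * S x3)))"
      by (subst sw_mult) (intro lin_intros | rule refl)+
    also have "\<dots> = sw sT y (\<lambda>y' y3. sT (ep y') (sT (ep x) (S y3 * S x3)))"
      using sw_antipode_left[of sT "\<lambda>z. z * c" for c]
      by (simp add: lin_intros counit_mult vs_simps[OF vector_space_axioms] mult.commute)
    also have "\<dots> = sT (ep x) (S y * S x3)"
      by (rule sw_counit_left) (intro lin_intros)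
    finally show ?case .
  qed (intro lin_intros)+
  with 1 show ?thesis by simp
qed

text \<open>Convolution inverses again, now of \<Delta> : T \<rightarrow> T \<otimes> T: one is
  \<Delta> after S, the other is S on both legs of the flipped coproduct. \<open>E\<close> places
  \<Delta> between them.\<close>

lemma sw_antipode:
  assumes "\<And>y. lin sT s (\<lambda>x. f x y)" "\<And>x. lin sT s (f x)"
  shows "sw s (S t) f = sw s t (\<lambda>x y. f (S y) (S x))"
proof -
  note f_lin = lin_comp[OF assms(1)] lin_comp[OF assms(2)]
  note vs = lin_vs2[OF assms(2)]
  define E where "E = sw s t (\<lambda>t1 r. sw s r (\<lambda>t2 r'. sw s r' (\<lambda>t3 r''. sw s r'' (\<lambda>t4 t5.
    sw s (S t1) (\<lambda>u v. f (u * (t2 * S t5)) (v * (t3 * S t4)))))))"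
  have "sw s r' (\<lambda>t3 r''. sw s r'' (\<lambda>t4 t5. sw s (S t1) (\<lambda>u v. f (u * (t2 * S t5)) (v * (t3 * S t4))))) =
      sw s (S t1) (\<lambda>u v. f (u * (t2 * S r')) v)" for t1 t2 r'
    using sw_antipode_right[of s "\<lambda>z. sw s (S t1) (\<lambda>u v. f (u * (t2 * S y)) (v * z))" for y]
    by (intro sw_collapse_left[where k = "\<lambda>t5. sw s (S t1) (\<lambda>u v. f (u * (t2 * S t5)) v)"])
      (simp_all add: lin_intros f_lin vs)
  then have "E = sw s t (\<lambda>t1 r. sw s r (\<lambda>t2 t5. sw s (S t1) (\<lambda>u v. f (u * (t2 * S t5)) v)))"
    by (simp add: E_def)
  also have "\<dots> = sw s (S t) f"
    using sw_antipode_right[of s "\<lambda>z. sw s (S t1) (\<lambda>u v. f (u * z) v)" for t1]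
    by (intro sw_collapse_right[where k = "\<lambda>t. sw s (S t) f"]) (simp_all add: lin_intros f_lin vs)
  finally have 1: "E = sw s (S t) f" .
  have "E = sw s t (\<lambda>t1 r. sw s r (\<lambda>q r''. sw s q (\<lambda>t2 t3. sw s r'' (\<lambda>t4 t5.
    sw s (S t1) (\<lambda>u v. f (u * (t2 * S t5)) (v * (t3 * S t4)))))))"
    unfolding E_def by (subst sw_coassoc) (intro lin_intros f_lin vs | rule refl)+
  also have "\<dots> = sw s t (\<lambda>x y. f (S y) (S x))"
  proof (rule sw_collapse_left[where k = "\<lambda>t. sw s t (\<lambda>x y. f (S y) (S x))"], goal_cases)
    case (5 x r)
    \<comment> \<open>The legs of \<open>q\<close> are moved inside the sum over the legs of S(t1),
      so that multiplicativity of the coproduct can be read backwards and gives \<Delta>(S(t1)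
      q).\<close>
    have "sw s q (\<lambda>t2 t3. sw s r (\<lambda>t4 t5. sw s (S t1) (\<lambda>u v. f (u * (t2 * S t5)) (v * (t3 * S t4))))) =
      sw s r (\<lambda>t4 t5. sw s (S t1) (\<lambda>u v. sw s q (\<lambda>t2 t3. f (u * (t2 * S t5)) (v * (t3 * S t4)))))" for t1 q
      unfolding lift_swap[OF vs, where P = "Dl q"] ..
    then have "sw s x (\<lambda>t1 q. sw s q (\<lambda>t2 t3. sw s r (\<lambda>t4 t5.
        sw s (S t1) (\<lambda>u v. f (u * (t2 * S t5)) (v * (t3 * S t4)))))) =
      sw s r (\<lambda>t4 t5. sw s x (\<lambda>t1 q. sw s (S t1) (\<lambda>u v. sw s q (\<lambda>t2 t3.
         f (u * (t2 * S t5)) (v * (t3 * S t4))))))"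
      by (simp only: lift_swap[OF vs, where P = "Dl x"])
    also have "\<dots> = sw s r (\<lambda>t4 t5. sw s x (\<lambda>t1 q. sw s (S t1 * q) (\<lambda>u v. f (u * S t5) (v * S t4))))"
      by (subst sw_mult) (intro lin_intros f_lin vs | simp add: mult.assoc)+
    also have "\<dots> = sw s r (\<lambda>t4 t5. s (ep x) (f (S t5) (S t4)))"
      using sw_antipode_left[of s "\<lambda>z. sw s z (\<lambda>u v. f (u * c) (v * d))" for c d]
      by (simp add: sw_one lin_intros f_lin vs)
    also have "\<dots> = s (ep x) (sw s r (\<lambda>x y. f (S y) (S x)))"
      by (rule lift_commute[symmetric]) (intro lin_intros vs)
    finally show ?case .
  qed (intro lin_intros f_lin vs)+
  finally show ?thesis using 1 by simp
qed

end

section \<open>Sweedler calculus for the coaction\<close>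

context yetter_drinfeld_algebra
begin

abbreviation cw :: "('k \<Rightarrow> 'z::ab_group_add \<Rightarrow> 'z) \<Rightarrow> 'a \<Rightarrow> ('a \<Rightarrow> 't \<Rightarrow> 'z) \<Rightarrow> 'z" where
  "cw s a f \<equiv> lift s f (rho a)"

lemma lin_cw [lin_intros]:
  assumes "lin s0 sA F" "\<And>y. lin sA s (\<lambda>x. f x y)" "\<And>x. lin sT s (f x)"
  shows "lin s0 s (\<lambda>v. cw s (F v) f)"
  by (rule lin_comp[OF lin_lift_quot_linear[OF coaction_linear A.vector_space_axioms
          lin_vs2[OF assms(3)] subspace_tensor_rel bilin_ext_zero[OF assms(2,3)]] assms(1)])

lemma lin_act_left: "lin sT sA (\<lambda>t. act t a)"
  and act_one: "act 1 a = a"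
  and act_mult: "act (x * y) a = act x (act y a)"
  using action by (simp_all add: left_action_def bilinear_map_def)

lemmas lin_act_left_comp [lin_intros] = lin_comp[OF lin_act_left]

lemma cw_one:
  assumes "\<And>y. lin sA s (\<lambda>x. f x y)" "\<And>x. lin sT s (f x)"
  shows "cw s 1 f = f 1 1"
  by (simp add: coaction_one lift_tcls[OF assms] lin_ext_gen[OF lin_vs2[OF assms(2)]])

lemma cw_mult:
  assumes "\<And>y. lin sA s (\<lambda>x. f x y)" "\<And>x. lin sT s (f x)"
  shows "cw s (a * b) f = cw s a (\<lambda>a0 a1. cw s b (\<lambda>b0 b1. f (a0 * b0) (b1 * a1)))"
  by (simp add: coaction_mult lift_tmult[OF assms])

lemma cw_coassoc:
  assumes "\<And>v w. lin sA s (\<lambda>u. f u v w)" "\<And>u w. lin sT s (\<lambda>v. f u v w)" "\<And>u v. lin sT s (f u v)"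
  shows "cw s a (\<lambda>a0 a1. cw s a0 (\<lambda>a00 a01. f a00 a01 a1)) = cw s a (\<lambda>a0 a1. sw s a1 (\<lambda>t1 t2. f a0 t1 t2))"
  using lift_cong_tcls3[OF assms coaction_coassoc[of a]]
  by (simp add: lin_ext_lift[OF lin_vs2[OF assms(3)]] lin_ext_gen[OF lin_vs2[OF assms(3)]])

lemma cw_counit: "lin sA s g \<Longrightarrow> cw s a (\<lambda>a0 a1. s (ep a1) (g a0)) = g a"
  using lift_commute[of sA s g "\<lambda>x y. sA (ep y) x" "rho a"]
  by (simp add: coaction_counit lin_scale[of sA s g])

lemma cw_yd:
  assumes "\<And>y. lin sA s (\<lambda>x. f x y)" "\<And>x. lin sT s (f x)"
  shows "sw s t (\<lambda>t1 t2. cw s a (\<lambda>a0 a1. f (act t1 a0) (t2 * a1))) =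
    sw s t (\<lambda>t1 t2. cw s (act t2 a) (\<lambda>b0 b1. f b0 (b1 * t1)))"
  using arg_cong[OF yetter_drinfeld[of a t], of "lift s f"] lin_vs2[OF assms(2)]
  by (simp add: lift_tcls[OF assms] lin_ext_lift lin_ext_gen)

text \<open>The Yetter-Drinfeld condition, rewritten with the antipode:
  \<open>t\<^sub>1 S(a\<^sub>[\<^sub>1\<^sub>]) \<otimes> t\<^sub>2 a\<^sub>[\<^sub>0\<^sub>] = S((t\<^sub>1 a)\<^sub>[\<^sub>1\<^sub>]) t\<^sub>2 \<otimes> (t\<^sub>1 a)\<^sub>[\<^sub>0\<^sub>]\<close>.\<close>

lemma cw_yd_antipode:
  assumes "\<And>y. lin sA s (\<lambda>x. f x y)" "\<And>x. lin sT s (f x)"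
  shows "sw s t (\<lambda>t1 t2. cw s a (\<lambda>a0 a1. f (act t2 a0) (t1 * S a1))) =
    sw s t (\<lambda>t1 t2. cw s (act t1 a) (\<lambda>b0 b1. f b0 (S b1 * t2)))"
proof -
  note f_lin = lin_comp[OF assms(1)] lin_comp[OF assms(2)]
  note vs = lin_vs2[OF assms(2)]
  let ?g = "\<lambda>x t1 t4. \<lambda>b u. f b (t1 * S u * t4)"
  have "sw s t (\<lambda>t1 t2. cw s a (\<lambda>a0 a1. f (act t2 a0) (t1 * S a1))) =
    sw s t (\<lambda>t1 r. sw s r (\<lambda>t2 r'. sw s r' (\<lambda>t3 t4. cw s a (\<lambda>a0 a1. f (act t2 a0) (t1 * S (t3 * a1) * t4)))))"
  proof -
    \<comment> \<open>A counit is inserted as S(t3) t4. As S(t3 a1) = S(a1) S(t3), this creates the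
      left side of \<open>cw_yd\<close> in the legs t2, t3.\<close>
    have "sw s r (\<lambda>t2 r'. sw s r' (\<lambda>t3 t4. cw s a (\<lambda>a0 a1. f (act t2 a0) (t1 * S (t3 * a1) * t4)))) =
        cw s a (\<lambda>a0 a1. f (act r a0) (t1 * S a1))" for r t1
      using sw_antipode_left[of s "\<lambda>z. cw s a (\<lambda>a0 a1. f (act x a0) (t1 * (S a1 * z)))" for x]
      by (intro sw_collapse_right[where k = "\<lambda>r. cw s a (\<lambda>a0 a1. f (act r a0) (t1 * S a1))"])
        (simp_all add: antipode_mult mult.assoc lin_intros f_lin vs)
    then show ?thesis by simp
  qed
  also have "\<dots> = sw s t (\<lambda>t1 r. sw s r (\<lambda>r' t4. sw s r' (\<lambda>t2 t3. cw s a (\<lambda>a0 a1. f (act t2 a0) (t1 * S (t3 * a1) * t4)))))"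
    by (subst sw_coassoc) (intro lin_intros f_lin vs | rule refl)+
  also have "\<dots> = sw s t (\<lambda>t1 r. sw s r (\<lambda>r' t4. sw s r' (\<lambda>t2 t3. cw s (act t3 a) (\<lambda>b0 b1. f b0 (t1 * S (b1 * t2) * t4)))))"
    by (subst cw_yd) (intro lin_intros f_lin vs | rule refl)+
  also have "\<dots> = sw s t (\<lambda>t1 r. sw s r (\<lambda>t2 r'. sw s r' (\<lambda>t3 t4. cw s (act t3 a) (\<lambda>b0 b1. f b0 (t1 * S (b1 * t2) * t4)))))"
    by (subst sw_coassoc) (intro lin_intros f_lin vs | rule refl)+
  \<comment> \<open>Now t1 S(b1 t2) contains t1 S(t2), which collapses.\<close>
  also have "\<dots> = sw s t (\<lambda>t1 t2. cw s (act t1 a) (\<lambda>b0 b1. f b0 (S b1 * t2)))"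
    using sw_antipode_right[of s "\<lambda>z. sw s y (\<lambda>t3 t4. cw s (act t3 a) (\<lambda>b0 b1. f b0 (z * (S b1 * t4))))" for y]
    by (intro sw_collapse_left[where k = "\<lambda>r. sw s r (\<lambda>t1 t2. cw s (act t1 a) (\<lambda>b0 b1. f b0 (S b1 * t2)))"])
      (simp_all add: antipode_mult mult.assoc lin_intros f_lin vs)
  finally show ?thesis .
qed

end

section \<open>Identities in the smash product\<close>

locale scalar_extension =
  braided_commutative_yd_algebra sT Dl ep S sA act rho + H: smash_product sT Dl sA act sH sharp
  for sT :: "'k::field \<Rightarrow> 't::{ring,monoid_mult} \<Rightarrow> 't" and Dl ep S
    and sA :: "'k \<Rightarrow> 'a::{ring,monoid_mult} \<Rightarrow> 'a" and act rho
    and sH :: "'k \<Rightarrow> 'h::{ring,monoid_mult} \<Rightarrow> 'h" and sharp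
begin

lemma cw_braided: "lin sA s g \<Longrightarrow> cw s x (\<lambda>x0 x1. g (x0 * act x1 a)) = g (a * x)"
  using lift_commute[of sA s g "\<lambda>x0 x1. x0 * act x1 a" "rho x"]
  by (simp add: braided_commutative)

lemma lin_ext_sharp_zero_iff: "lin_ext sH (\<lambda>(a, t). sharp a t) p = 0 \<longleftrightarrow> p \<in> tensor_rel sA sT"
  using H.tensor_product unfolding is_tensor_product_def by blast

text \<open>The kernel of the map induced by \<open>sharp\<close> consists of the tensor relations,
  so each bilinearity relation becomes an equation for \<open>sharp\<close>.\<close>

lemma lin_sharp_left: "lin sA sH (\<lambda>a. sharp a t)"
  and lin_sharp_right: "lin sT sH (sharp a)"
proof -
  note ex = lin_ext_expand[OF H.vector_space_axioms]
  have r: "r \<in> bilin_rels sA sT \<Longrightarrow> lin_ext sH (\<lambda>(a, t). sharp a t) r = 0" for r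
    by (simp add: lin_ext_sharp_zero_iff tensor_rel_def free.span_base)
  show "lin sA sH (\<lambda>a. sharp a t)"
  proof (rule linI[OF A.vector_space_axioms H.vector_space_axioms])
    fix x y c
    show "sharp (x + y) t = sharp x t + sharp y t"
      using r[of "gen (x + y, t) - gen (x, t) - gen (y, t)"]
      by (simp add: ex bilin_rels_def algebra_simps) blast
    show "sharp (sA c x) t = sH c (sharp x t)"
      using r[of "gen (sA c x, t) - fscale c (gen (x, t))"]
      by (simp add: ex bilin_rels_def) blast
  qed
  show "lin sT sH (sharp a)"
  proof (rule linI[OF vector_space_axioms H.vector_space_axioms])
    fix x y c
    show "sharp a (x + y) = sharp a x + sharp a y"
      using r[of "gen (a, x + y) - gen (a, x) - gen (a, y)"]
      by (simp add: ex bilin_rels_def algebra_simps) blast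
    show "sharp a (sT c x) = sH c (sharp a x)"
      using r[of "gen (a, sT c x) - fscale c (gen (a, x))"]
      by (simp add: ex bilin_rels_def) blast
  qed
qed

lemmas lin_sharp_left_comp = lin_comp[OF lin_sharp_left]
lemmas lin_sharp_right_comp = lin_comp[OF lin_sharp_right]
lemmas lin_sharp = lin_sharp_left_comp lin_sharp_right_comp

abbreviation al :: "'a \<Rightarrow> 'h" where "al \<equiv> ext_alpha sharp"
abbreviation be :: "'a \<Rightarrow> 'h" where "be \<equiv> ext_beta sH sharp rho"
abbreviation ta :: "'h \<Rightarrow> 'h" where "ta \<equiv> ext_antipode sH sharp S rho"
abbreviation eps :: "'h \<Rightarrow> 'a" where "eps \<equiv> ext_counit sA ep sH sharp"
text \<open>With \<open>al\<close> this factors a # t as \<open>al a * io t\<close>, and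
  computations in H become commutation rules between the two embedded algebras.\<close>

definition io :: "'t \<Rightarrow> 'h" where "io t = sharp 1 t"

lemma lin_al: "lin sA sH al" and lin_io: "lin sT sH io"
  using lin_sharp_left[of 1] lin_sharp_right[of 1]
  by (simp_all add: ext_alpha_def[abs_def] io_def[abs_def])

lemmas lin_al_comp [lin_intros] = lin_comp[OF lin_al]
lemmas lin_io_comp [lin_intros] = lin_comp[OF lin_io]

lemma al_one: "al 1 = 1" and io_one: "io 1 = 1"
  by (simp_all add: ext_alpha_def io_def H.sharp_one)

lemma sharp_eq: "sharp a t = al a * io t"
  unfolding ext_alpha_def io_def H.sharp_mult
  by (subst sw_one) (intro lin_intros lin_sharp | simp add: act_one)+

lemma al_mult: "al (a * b) = al a * al b"
  unfolding ext_alpha_def H.sharp_mult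
  by (subst sw_one) (intro lin_intros lin_sharp | simp add: act_one)+

lemma io_mult: "io (t * t') = io t * io t'"
  using sw_counit_left[of sH "\<lambda>u. io (u * t')" t]
  by (simp add: io_def H.sharp_mult action_one lin_scale[OF lin_sharp_left] lin_intros lin_sharp)

lemma io_al: "io t * al a = sw sH t (\<lambda>t1 t2. al (act t1 a) * io t2)"
  using H.sharp_mult[of 1 t a 1]
  by (simp only: sharp_eq al_one io_one mult_1_left mult_1_right)

section \<open>Linear maps out of the smash product\<close>

lemma smash_obtain:
  obtains p where "h = lin_ext sH (\<lambda>(a, t). sharp a t) p" "as_tensor sH sharp h = tcls sA sT p"
proof -
  have "surj (lin_ext sH (\<lambda>(a, t). sharp a t))"
    using H.tensor_product by (simp add: is_tensor_product_def)
  then obtain p where p: "h = lin_ext sH (\<lambda>(a, t). sharp a t) p" by (rule surjE)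
  have "as_tensor sH sharp h = tcls sA sT p"
    unfolding as_tensor_def qcls_def lin_ext_sharp_zero_iff[symmetric] p
    by (simp add: lin_diff[OF lin_lin_ext[OF H.vector_space_axioms]])
  with p that show ?thesis by blast
qed

lemma smash_linear_eqI:
  assumes "lin sH s F" "lin sH s G" "\<And>a t. F (al a * io t) = G (al a * io t)"
  shows "F h = G h"
proof -
  obtain p where "h = lin_ext sH (\<lambda>(a, t). sharp a t) p" by (rule smash_obtain)
  then show ?thesis
    using assms(3) by (simp add: lin_ext_commute[OF assms(1)] lin_ext_commute[OF assms(2)]
        case_prod_unfold sharp_eq)
qed

abbreviation hl :: "('k \<Rightarrow> 'z::ab_group_add \<Rightarrow> 'z) \<Rightarrow> ('a \<Rightarrow> 't \<Rightarrow> 'z) \<Rightarrow> 'h \<Rightarrow> 'z" where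
  "hl s f h \<equiv> lift s f (as_tensor sH sharp h)"

lemma hl_sharp:
  assumes "\<And>t. lin sA s (\<lambda>a. f a t)" "\<And>a. lin sT s (f a)"
  shows "hl s f (al a * io t) = f a t"
proof -
  obtain p where p: "al a * io t = lin_ext sH (\<lambda>(a, t). sharp a t) p"
    "as_tensor sH sharp (al a * io t) = tcls sA sT p" by (rule smash_obtain)
  have "gen (a, t) - p \<in> tensor_rel sA sT"
    using p(1) by (simp add: lin_ext_expand[OF H.vector_space_axioms] sharp_eq flip: lin_ext_sharp_zero_iff)
  then have "lin_ext s (\<lambda>(a, t). f a t) (gen (a, t) - p) = 0"
    by (rule bilin_ext_zero[OF assms])
  then show ?thesis
    by (simp add: p(2) lift_tcls[OF assms] lin_ext_expand[OF lin_vs2[OF assms(2)]])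
qed

lemma lin_hl:
  assumes "\<And>t. lin sA s (\<lambda>a. f a t)" "\<And>a. lin sT s (f a)"
  shows "lin sH s (hl s f)"
proof (rule linI[OF H.vector_space_axioms lin_vs2[OF assms(2)]])
  have *: "hl s f (lin_ext sH (\<lambda>(a, t). sharp a t) p) = lin_ext s (\<lambda>(a, t). f a t) p" for p
  proof -
    obtain q where q: "lin_ext sH (\<lambda>(a, t). sharp a t) p = lin_ext sH (\<lambda>(a, t). sharp a t) q"
      "as_tensor sH sharp (lin_ext sH (\<lambda>(a, t). sharp a t) p) = tcls sA sT q" by (rule smash_obtain)
    have "p - q \<in> tensor_rel sA sT"
      using q(1) by (simp add: lin_ext_expand[OF H.vector_space_axioms] flip: lin_ext_sharp_zero_iff)
    then have "lin_ext s (\<lambda>(a, t). f a t) (p - q) = 0"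
      by (rule bilin_ext_zero[OF assms])
    then show ?thesis
      by (simp add: q(2) lift_tcls[OF assms] lin_ext_expand[OF lin_vs2[OF assms(2)]])
  qed
  fix x y c
  obtain p q where "x = lin_ext sH (\<lambda>(a, t). sharp a t) p" "y = lin_ext sH (\<lambda>(a, t). sharp a t) q"
    using smash_obtain by metis
  then show "hl s f (x + y) = hl s f x + hl s f y" "hl s f (sH c x) = s c (hl s f x)"
    by (simp_all add: * lin_ext_expand[OF lin_vs2[OF assms(2)]]
        flip: lin_add[OF lin_lin_ext[OF H.vector_space_axioms]] lin_scale[OF lin_lin_ext[OF H.vector_space_axioms]])
qed

section \<open>The target map \<beta> and its commutation rules\<close>

lemma be_eq: "be a = cw sH a (\<lambda>a0 a1. al a0 * io a1)"
  by (simp only: ext_beta_def sharp_eq[symmetric])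

lemma lin_be: "lin sA sH be"
  by (simp add: be_eq[abs_def]) (intro lin_intros)

lemmas lin_be_comp [lin_intros] = lin_comp[OF lin_be]

lemma lift_mult_left: "c * lift sH f P = lift sH (\<lambda>x y. c * f x y) P"
  and lift_mult_right: "lift sH f P * c = lift sH (\<lambda>x y. f x y * c) P"
  by (rule lift_commute, intro lin_intros)+

text \<open>Moving b to the left of x1 produces x0 (x1 acting on b) with one leg left over;
  coassociativity turns the first two legs into an instance of braided commutativity.\<close>

lemma be_al: "be x * al b = al b * be x"
proof -
  have "be x * al b = cw sH x (\<lambda>x0 x1. sw sH x1 (\<lambda>u v. al x0 * al (act u b) * io v))"
    by (simp add: be_eq lift_mult_right lift_mult_left mult.assoc io_al)
  also have "\<dots> = cw sH x (\<lambda>x0 x1. cw sH x0 (\<lambda>x00 x01. al (x00 * act x01 b) * io x1))"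
    unfolding al_mult by (subst cw_coassoc) (intro lin_intros | rule refl)+
  also have "\<dots> = cw sH x (\<lambda>x0 x1. al (b * x0) * io x1)"
    using cw_braided[of sH "\<lambda>z. al z * io y" for y] by (simp add: lin_intros)
  also have "\<dots> = al b * be x"
    by (simp add: be_eq lift_mult_left al_mult mult.assoc)
  finally show ?thesis .
qed

lemma be_one: "be 1 = 1"
  unfolding be_eq by (subst cw_one) (intro lin_intros | simp add: al_one io_one)+

text \<open>The coaction is multiplicative for the opposite product on T, so \<beta>(a) appears
  nested inside \<beta>(b); \<open>be_al\<close> extracts it.\<close>

lemma be_mult: "be (b * a) = be a * be b"
proof -
  have "be (b * a) = cw sH b (\<lambda>b0 b1. cw sH a (\<lambda>a0 a1. al b0 * (al a0 * io a1) * io b1))"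
    unfolding be_eq by (subst cw_mult) (intro lin_intros | simp add: al_mult io_mult mult.assoc)+
  also have "\<dots> = cw sH b (\<lambda>b0 b1. al b0 * be a * io b1)"
    by (simp add: be_eq[of a] lift_mult_left lift_mult_right)
  also have "\<dots> = cw sH b (\<lambda>b0 b1. be a * (al b0 * io b1))"
    by (simp only: be_al[symmetric] mult.assoc)
  also have "\<dots> = be a * be b"
    by (simp add: be_eq[of b] lift_mult_left)
  finally show ?thesis .
qed

text \<open>The Yetter-Drinfeld condition as a commutation rule. Here the second leg acts and the
  first remains, the reverse of \<open>io_al\<close>; together the two rules make \<Delta>_T(t)
  preserve I_A.\<close>

lemma io_be: "io t * be a = sw sH t (\<lambda>t1 t2. be (act t2 a) * io t1)"
proof -
  have "io t * be a = cw sH a (\<lambda>a0 a1. sw sH t (\<lambda>t1 t2. al (act t1 a0) * io (t2 * a1)))"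
    by (simp only: be_eq lift_mult_left lift_mult_right io_al io_mult mult.assoc[symmetric])
  also have "\<dots> = sw sH t (\<lambda>t1 t2. cw sH a (\<lambda>a0 a1. al (act t1 a0) * io (t2 * a1)))"
    by (rule lift_swap[OF H.vector_space_axioms])
  also have "\<dots> = sw sH t (\<lambda>t1 t2. cw sH (act t2 a) (\<lambda>b0 b1. al b0 * io (b1 * t1)))"
    by (subst cw_yd) (intro lin_intros | rule refl)+
  also have "\<dots> = sw sH t (\<lambda>t1 t2. be (act t2 a) * io t1)"
    by (simp add: be_eq lift_mult_right io_mult mult.assoc)
  finally show ?thesis .
qed

text \<open>The cancellation a0 a1 S(a2) = a. It explains the shape of the twisted generators: once
  a0 crosses the balanced tensor sign as \<beta>(a0), it meets S(a1).\<close>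

lemma cw_be_antipode: "cw sH a (\<lambda>a0 a1. be a0 * io (S a1)) = al a"
proof -
  have "cw sH a (\<lambda>a0 a1. be a0 * io (S a1)) =
      cw sH a (\<lambda>a0 a1. cw sH a0 (\<lambda>a00 a01. al a00 * io (a01 * S a1)))"
    by (simp add: be_eq lift_mult_right io_mult mult.assoc)
  also have "\<dots> = cw sH a (\<lambda>a0 a1. sw sH a1 (\<lambda>x y. al a0 * io (x * S y)))"
    by (subst cw_coassoc) (intro lin_intros | rule refl)+
  also have "\<dots> = al a"
    using sw_antipode_right[of sH "\<lambda>z. al y * io z" for y] cw_counit[OF lin_al]
    by (simp add: lin_intros io_one)
  finally show ?thesis .
qed

text \<open>\<open>io_be\<close> solved for \<beta>, so that acting by S(r) becomes a conjugation in
  H.\<close>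

lemma be_act_antipode: "be (act (S r) a) = sw sH r (\<lambda>r1 r2. io (S r1) * be a * io r2)"
proof -
  have "io (S x) * be a = sw sH x (\<lambda>p q. be (act (S p) a) * io (S q))" for x
    unfolding io_be by (subst sw_antipode) (intro lin_intros | rule refl)+
  then have "sw sH r (\<lambda>r1 r2. io (S r1) * be a * io r2) =
      sw sH r (\<lambda>r1 r2. sw sH r1 (\<lambda>p q. be (act (S p) a) * io (S q * r2)))"
    by (simp add: lift_mult_right io_mult mult.assoc)
  also have "\<dots> = sw sH r (\<lambda>p r2. sw sH r2 (\<lambda>q r2. be (act (S p) a) * io (S q * r2)))"
    by (subst sw_coassoc) (intro lin_intros | rule refl)+
  also have "\<dots> = be (act (S r) a)"
    using sw_antipode_left[of sH "\<lambda>z. be (act (S x) a) * io z" for x]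
    by (intro sw_collapse_right[where k = "\<lambda>p. be (act (S p) a)"]) (simp_all add: lin_intros io_one)
  finally show ?thesis by simp
qed

text \<open>\<open>io_al\<close> solved for the opposite order of the factors.\<close>

lemma al_io_antipode: "al b * io (S y) = sw sH y (\<lambda>y1 y2. io (S y1) * al (act y2 b))"
proof -
  have "io (S x) * al c = sw sH x (\<lambda>p q. al (act (S q) c) * io (S p))" for x c
    unfolding io_al by (subst sw_antipode) (intro lin_intros | rule refl)+
  then have "sw sH y (\<lambda>y1 y2. io (S y1) * al (act y2 b)) =
      sw sH y (\<lambda>y1 y2. sw sH y1 (\<lambda>p q. al (act (S q * y2) b) * io (S p)))"
    by (simp add: act_mult)
  also have "\<dots> = sw sH y (\<lambda>p y2. sw sH y2 (\<lambda>q y2. al (act (S q * y2) b) * io (S p)))"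
    by (subst sw_coassoc) (intro lin_intros | rule refl)+
  also have "\<dots> = al b * io (S y)"
    using sw_antipode_left[of sH "\<lambda>z. al (act z b) * io (S x)" for x]
    by (intro sw_collapse_right[where k = "\<lambda>p. al b * io (S p)"]) (simp_all add: lin_intros act_one)
  finally show ?thesis by simp
qed

text \<open>The restriction of \<tau> to A, namely S^2(a1) a0.\<close>

definition tA :: "'a \<Rightarrow> 'h" where
  "tA a = cw sH a (\<lambda>a0 a1. io (S (S a1)) * al a0)"

lemma lin_tA: "lin sA sH tA"
  by (simp add: tA_def[abs_def]) (intro lin_intros)

lemmas lin_tA_comp [lin_intros] = lin_comp[OF lin_tA]

text \<open>Moving b past S^2(a1) makes S of a leg act on b. Braided commutativity then exchanges
  the result with a0 and adds a second action by a coaction leg, and the two legs cancel as t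
  S(x1).\<close>

lemma al_tA: "al b * tA a = tA a * al b"
proof -
  have 1: "al b * io (S (S x)) = sw sH x (\<lambda>x1 x2. io (S (S x2)) * al (act (S x1) b))" for x
    unfolding al_io_antipode by (subst sw_antipode) (intro lin_intros | rule refl)+
  then have 3: "al b * (io (S (S x)) * z) = sw sH x (\<lambda>x1 x2. io (S (S x2)) * (al (act (S x1) b) * z))" for x z
    by (simp only: mult.assoc[symmetric] lift_mult_right)
  have 2: "al c * al x = cw sH x (\<lambda>x0 x1. al (x0 * act x1 c))" for c x
    unfolding al_mult[symmetric] by (rule cw_braided[OF lin_al, symmetric])
  have "al b * tA a = cw sH a (\<lambda>a0 a1. sw sH a1 (\<lambda>x1 x2. io (S (S x2)) * (al (act (S x1) b) * al a0)))"
    by (simp only: tA_def lift_mult_left 3 mult.assoc)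
  also have "\<dots> = cw sH a (\<lambda>a0 a1. sw sH a1 (\<lambda>x1 x2. cw sH a0 (\<lambda>a00 a01.
      io (S (S x2)) * al (a00 * act (a01 * S x1) b))))"
    by (simp add: 2 lift_mult_left act_mult)
  also have "\<dots> = cw sH a (\<lambda>a0 a1. cw sH a0 (\<lambda>a00 a01. sw sH a1 (\<lambda>x1 x2.
      io (S (S x2)) * al (a00 * act (a01 * S x1) b))))"
    by (subst lift_swap[OF H.vector_space_axioms]) (rule refl)
  also have "\<dots> = cw sH a (\<lambda>a0 a1. sw sH a1 (\<lambda>t y. sw sH y (\<lambda>x1 x2.
      io (S (S x2)) * al (a0 * act (t * S x1) b))))"
    by (subst cw_coassoc) (intro lin_intros | rule refl)+
  also have "\<dots> = cw sH a (\<lambda>a0 a1. io (S (S a1)) * al (a0 * b))"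
  proof -
    have "sw sH a1 (\<lambda>t y. sw sH y (\<lambda>x1 x2. io (S (S x2)) * al (a0 * act (t * S x1) b))) =
      io (S (S a1)) * al (a0 * b)" for a0 a1
      using sw_antipode_right[of sH "\<lambda>z. io (S (S x)) * al (a0 * act z b)" for x]
      by (intro sw_collapse_left[where k = "\<lambda>r. io (S (S r)) * al (a0 * b)"])
        (simp_all add: lin_intros act_one)
    then show ?thesis by simp
  qed
  also have "\<dots> = tA a * al b"
    by (simp add: tA_def lift_mult_right al_mult mult.assoc)
  finally show ?thesis .
qed

lemma tA_mult: "tA (a * b) = tA b * tA a"
proof -
  have "tA (a * b) = cw sH a (\<lambda>a0 a1. cw sH b (\<lambda>b0 b1.
      io (S (S b1)) * (io (S (S a1)) * al a0) * al b0))"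
    unfolding tA_def by (subst cw_mult) (intro lin_intros | simp add: al_mult io_mult antipode_mult mult.assoc)+
  also have "\<dots> = cw sH b (\<lambda>b0 b1. io (S (S b1)) * tA a * al b0)"
    by (subst lift_swap[OF H.vector_space_axioms]) (simp add: tA_def lift_mult_left lift_mult_right)
  also have "\<dots> = cw sH b (\<lambda>b0 b1. io (S (S b1)) * al b0 * tA a)"
    by (simp add: mult.assoc al_tA)
  also have "\<dots> = tA b * tA a"
    by (simp add: tA_def[of b] lift_mult_right)
  finally show ?thesis .
qed

lemma tA_one: "tA 1 = 1"
  unfolding tA_def by (subst cw_one) (intro lin_intros | simp add: al_one io_one antipode_one)+

text \<open>The image under \<tau> of the straightening rule \<open>io_al\<close>. It rests on the
  Yetter-Drinfeld condition in its antipode form.\<close>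

lemma tA_io_antipode: "sw sH t (\<lambda>t1 t2. io (S t2) * tA (act t1 a)) = tA a * io (S t)"
proof -
  have "sw sH t (\<lambda>t1 t2. io (S t2) * tA (act t1 a)) =
      sw sH t (\<lambda>t1 t2. cw sH (act t1 a) (\<lambda>b0 b1. io (S (S b1 * t2)) * al b0))"
    by (simp add: tA_def lift_mult_left antipode_mult io_mult mult.assoc)
  also have "\<dots> = sw sH t (\<lambda>t1 t2. cw sH a (\<lambda>a0 a1. io (S (t1 * S a1)) * al (act t2 a0)))"
    by (subst cw_yd_antipode) (intro lin_intros | rule refl)+
  also have "\<dots> = cw sH a (\<lambda>a0 a1. sw sH t (\<lambda>t1 t2. io (S (t1 * S a1)) * al (act t2 a0)))"
    by (rule lift_swap[OF H.vector_space_axioms])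
  also have "\<dots> = tA a * io (S t)"
    by (simp add: tA_def lift_mult_right al_io_antipode lift_mult_left antipode_mult io_mult mult.assoc)
  finally show ?thesis .
qed

text \<open>Since S(a2) S^2(a1) = S(S(a1) a2), the antipode axiom applies under S. This yields both
  \<tau>\<beta> = \<alpha> and the value of \<phi> on twisted generators.\<close>

lemma cw_antipode_tA: "cw sH a (\<lambda>a0 a1. io (S a1) * tA a0) = al a"
proof -
  have "cw sH a (\<lambda>a0 a1. io (S a1) * tA a0) =
      cw sH a (\<lambda>a0 a1. cw sH a0 (\<lambda>a00 a01. io (S (S a01 * a1)) * al a00))"
    by (simp add: tA_def lift_mult_left antipode_mult io_mult mult.assoc)
  also have "\<dots> = cw sH a (\<lambda>a0 a1. sw sH a1 (\<lambda>x y. io (S (S x * y)) * al a0))"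
    by (subst cw_coassoc) (intro lin_intros | rule refl)+
  also have "\<dots> = al a"
    using sw_antipode_left[of sH "\<lambda>z. io (S z) * al y" for y] cw_counit[OF lin_al]
    by (simp add: lin_intros io_one antipode_one)
  finally show ?thesis .
qed

section \<open>The antipode \<tau> of the smash product\<close>

lemma ta_eq: "ta h = hl sH (\<lambda>a t. io (S t) * tA a) h"
  by (simp add: ext_antipode_def tA_def io_def ext_alpha_def)

lemma lin_ta: "lin sH sH ta"
  unfolding ta_eq[abs_def] by (rule lin_hl; intro lin_intros)

lemmas lin_ta_comp [lin_intros] = lin_comp[OF lin_ta]

lemma ta_sharp: "ta (al a * io t) = io (S t) * tA a"
  unfolding ta_eq by (rule hl_sharp; intro lin_intros)

lemma ta_al: "ta (al a) = tA a" and ta_io: "ta (io t) = io (S t)"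
  using ta_sharp[of a 1] ta_sharp[of 1 t] by (simp_all add: al_one io_one antipode_one tA_one)

lemma ta_one: "ta 1 = 1"
  using ta_io[of 1] by (simp add: io_one antipode_one)

lemma sharp_mult_sharp: "(al a * io t) * (al a' * io t') = sw sH t (\<lambda>t1 t2. al (a * act t1 a') * io (t2 * t'))"
  using H.sharp_mult[of a t a' t'] by (simp add: sharp_eq)

text \<open>Reversal holds within T and within A separately; the mixed relation of the smash product
  is covered by \<open>tA_io_antipode\<close>.\<close>

lemma ta_mult: "ta (h * h') = ta h' * ta h"
proof -
  have 1: "ta (al a * io t * (al a' * io t')) = ta (al a' * io t') * ta (al a * io t)" for a t a' t'
  proof -
    have "ta (al a * io t * (al a' * io t')) =
        sw sH t (\<lambda>t1 t2. io (S t') * (io (S t2) * tA (act t1 a')) * tA a)"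
      unfolding sharp_mult_sharp
      by (simp only: lift_commute[OF lin_ta] ta_sharp)
        (simp only: tA_mult antipode_mult io_mult mult.assoc)
    also have "\<dots> = io (S t') * (tA a' * io (S t)) * tA a"
      by (simp add: lift_mult_left lift_mult_right flip: tA_io_antipode)
    finally show ?thesis by (simp add: ta_sharp mult.assoc)
  qed
  have 2: "ta (al a * io t * h') = ta h' * ta (al a * io t)" for a t
    by (rule smash_linear_eqI[where s = sH and F = "\<lambda>h'. ta (al a * io t * h')" and G = "\<lambda>h'. ta h' * ta (al a * io t)"])
      (intro lin_intros | rule 1)+
  show ?thesis
    by (rule smash_linear_eqI[where s = sH and F = "\<lambda>h. ta (h * h')" and G = "\<lambda>h. ta h' * ta h"])
      (intro lin_intros | rule 2)+
qed

lemma ta_be: "ta (be a) = al a"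
  by (simp add: be_eq lift_commute[OF lin_ta] ta_sharp cw_antipode_tA)

section \<open>The counit of the smash product\<close>

lemma lin_eps: "lin sH sA eps"
  unfolding ext_counit_def[abs_def] by (rule lin_hl; intro lin_intros)

lemmas lin_eps_comp [lin_intros] = lin_comp[OF lin_eps]

lemma eps_sharp: "eps (al a * io t) = sA (ep t) a"
  unfolding ext_counit_def by (rule hl_sharp; intro lin_intros)

lemma eps_one: "eps 1 = 1"
  using eps_sharp[of 1 1] by (simp add: al_one io_one counit_one vs_simps(6)[OF A.vector_space_axioms])

lemma eps_al: "eps (al a * h) = a * eps h"
proof (rule smash_linear_eqI[where s = sA and F = "\<lambda>h. eps (al a * h)" and G = "\<lambda>h. a * eps h"])
  show "eps (al a * (al b * io t)) = a * eps (al b * io t)" for b t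
    using eps_sharp[of "a * b" t] by (simp add: eps_sharp al_mult mult.assoc A.scale_mult_right)
qed (intro lin_intros)+

text \<open>After \<beta>(b) is moved behind a, the counit of T removes its coaction leg.\<close>

lemma eps_be: "eps (be b * h) = eps h * b"
proof (rule smash_linear_eqI[where s = sA and F = "\<lambda>h. eps (be b * h)" and G = "\<lambda>h. eps h * b"])
  show "eps (be b * (al a * io t)) = eps (al a * io t) * b" for a t
  proof -
    have "be b * (al a * io t) = cw sH b (\<lambda>b0 b1. al (a * b0) * io (b1 * t))"
      unfolding mult.assoc[symmetric] be_al
      by (simp add: be_eq lift_mult_left lift_mult_right al_mult io_mult mult.assoc)
    then have "eps (be b * (al a * io t)) = cw sA b (\<lambda>b0 b1. sA (ep b1) (sA (ep t) (a * b0)))"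
      by (simp add: lift_commute[OF lin_eps] eps_sharp counit_mult vs_simps(7)[OF A.vector_space_axioms])
    also have "\<dots> = sA (ep t) (a * b)"
      by (rule cw_counit) (intro lin_intros)
    finally show ?thesis by (simp add: eps_sharp A.scale_mult_left)
  qed
qed (intro lin_intros)+

lemma eps_io_al: "eps (io t * al b) = act t b"
proof -
  have "eps (io t * al b) = sw sA t (\<lambda>t1 t2. sA (ep t2) (act t1 b))"
    by (simp add: io_al lift_commute[OF lin_eps] eps_sharp)
  also have "\<dots> = act t b"
    by (rule sw_counit_right) (rule lin_act_left)
  finally show ?thesis .
qed

lemma eps_action: "eps (al a * io t * al b) = a * act t b"
  by (simp add: mult.assoc eps_al eps_io_al)

text \<open>\<epsilon>\<tau>(a # t) is S(S(a1) t) acting on a0, so \<beta> of it is a conjugation by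
  legs of S(a1) t. The coproduct of this product separates the legs of t from those of a1, and the
  latter combine with \<beta>(a0) to \<open>tA a\<close>.\<close>

lemma antipode_left_sharp:
  "sw sH t (\<lambda>t1 t2. ta (al a * io t1) * io t2) = be (eps (ta (al a * io t)))"
proof -
  have *: "cw sH a (\<lambda>a0 a1. sw sH a1 (\<lambda>x y. io (S (S y)) * be a0 * io (S x))) = tA a"
  proof -
    have "cw sH a (\<lambda>a0 a1. sw sH a1 (\<lambda>x y. io (S (S y)) * be a0 * io (S x))) =
      cw sH a (\<lambda>a0 a1. sw sH a1 (\<lambda>x y. cw sH a0 (\<lambda>a00 a01. io (S (S y)) * al a00 * io (a01 * S x))))"
      by (simp add: be_eq lift_mult_left lift_mult_right io_mult mult.assoc)
    also have "\<dots> = cw sH a (\<lambda>a0 a1. cw sH a0 (\<lambda>a00 a01. sw sH a1 (\<lambda>x y. io (S (S y)) * al a00 * io (a01 * S x))))"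
      by (subst lift_swap[OF H.vector_space_axioms]) (rule refl)
    also have "\<dots> = cw sH a (\<lambda>a0 a1. sw sH a1 (\<lambda>z r. sw sH r (\<lambda>x y. io (S (S y)) * al a0 * io (z * S x))))"
      by (subst cw_coassoc) (intro lin_intros | rule refl)+
    also have "\<dots> = tA a"
    proof -
      have "sw sH a1 (\<lambda>z r. sw sH r (\<lambda>x y. io (S (S y)) * al a0 * io (z * S x))) = io (S (S a1)) * al a0" for a0 a1
        using sw_antipode_right[of sH "\<lambda>z. io (S (S x)) * al a0 * io z" for x]
        by (intro sw_collapse_left[where k = "\<lambda>r. io (S (S r)) * al a0"])
          (simp_all add: lin_intros io_one)
      then show ?thesis by (simp add: tA_def)
    qed
    finally show ?thesis .
  qed
  have "ta (al a * io t) = cw sH a (\<lambda>a0 a1. io (S (S a1 * t)) * al a0)"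
    by (simp add: ta_sharp tA_def lift_mult_left antipode_mult io_mult mult.assoc)
  then have "eps (ta (al a * io t)) = cw sA a (\<lambda>a0 a1. act (S (S a1 * t)) a0)"
    by (simp add: lift_commute[OF lin_eps] eps_io_al)
  then have "be (eps (ta (al a * io t))) = cw sH a (\<lambda>a0 a1. sw sH (S a1 * t) (\<lambda>u v. io (S u) * be a0 * io v))"
    by (simp add: lift_commute[OF lin_be] be_act_antipode)
  also have "\<dots> = cw sH a (\<lambda>a0 a1. sw sH (S a1) (\<lambda>p q. sw sH t (\<lambda>t1 t2. io (S (p * t1)) * be a0 * io (q * t2))))"
    by (subst sw_mult) (intro lin_intros | rule refl)+
  also have "\<dots> = cw sH a (\<lambda>a0 a1. sw sH a1 (\<lambda>x y. sw sH t (\<lambda>t1 t2. io (S (S y * t1)) * be a0 * io (S x * t2))))"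
    by (subst sw_antipode) (intro lin_intros | rule refl)+
  also have "\<dots> = cw sH a (\<lambda>a0 a1. sw sH t (\<lambda>t1 t2. sw sH a1 (\<lambda>x y. io (S (S y * t1)) * be a0 * io (S x * t2))))"
    by (subst lift_swap[OF H.vector_space_axioms]) (rule refl)
  also have "\<dots> = sw sH t (\<lambda>t1 t2. cw sH a (\<lambda>a0 a1. sw sH a1 (\<lambda>x y. io (S (S y * t1)) * be a0 * io (S x * t2))))"
    by (rule lift_swap[OF H.vector_space_axioms])
  also have "\<dots> = sw sH t (\<lambda>t1 t2. io (S t1) * tA a * io t2)"
    by (simp add: antipode_mult io_mult lift_mult_left lift_mult_right mult.assoc flip: *)
  finally show ?thesis by (simp add: ta_sharp)
qed

end

section \<open>The algebra \<open>H \<otimes> H\<close> on representatives\<close>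

context k_algebra
begin

abbreviation N :: "('a \<times> 'a \<Rightarrow>\<^sub>0 'k) set" where "N \<equiv> tensor_rel s s"

text \<open>The product of the monoid algebra of pairs. It is associative and unital before
  relations are divided out, unlike \<open>tmult\<close>, which refers to chosen
  representatives.\<close>

definition rep_mult :: "('a \<times> 'a \<Rightarrow>\<^sub>0 'k) \<Rightarrow> ('a \<times> 'a \<Rightarrow>\<^sub>0 'k) \<Rightarrow> ('a \<times> 'a \<Rightarrow>\<^sub>0 'k)" where
  "rep_mult p q = lin_ext fscale (\<lambda>(x, y). lin_ext fscale (\<lambda>(x', y'). gen (x * x', y * y')) q) p"

text \<open>Stands for x \<otimes> y, but with values in a vector space that is a type, so linearity
  statements apply.\<close>

definition tN :: "'a \<Rightarrow> 'a \<Rightarrow> ('a \<times> 'a \<Rightarrow>\<^sub>0 'k)" where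
  "tN x y = qpr N (gen (x, y))"

lemma lin_rep_mult_left: "lin fscale fscale (\<lambda>p. rep_mult p q)"
  unfolding rep_mult_def by (rule lin_lin_ext[OF free.vector_space_axioms])

lemma lin_rep_mult_right: "lin fscale fscale (rep_mult p)"
  unfolding rep_mult_def[abs_def] case_prod_unfold
  by (intro lin_ext_fun lin_lin_ext free.vector_space_axioms)

lemmas lin_rep_mult [lin_intros] = lin_comp[OF lin_rep_mult_left] lin_comp[OF lin_rep_mult_right]
lemmas rep_mult_left = lin_add[OF lin_rep_mult_left] lin_diff[OF lin_rep_mult_left] lin_scale[OF lin_rep_mult_left] lin_zero[OF lin_rep_mult_left]
lemmas rep_mult_right = lin_add[OF lin_rep_mult_right] lin_diff[OF lin_rep_mult_right] lin_scale[OF lin_rep_mult_right] lin_zero[OF lin_rep_mult_right]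

lemma lin_rep_mult_gen_right:
  assumes "lin fscale s' F"
  shows "F (rep_mult p (gen (x, y))) = lin_ext s' (\<lambda>(u, v). F (gen (u * x, v * y))) p"
  by (simp add: rep_mult_def lin_ext_gen free.vector_space_axioms lin_ext_commute[OF assms] case_prod_unfold)

lemma lin_rep_mult_gen_left:
  assumes "lin fscale s' F"
  shows "F (rep_mult (gen (x, y)) p) = lin_ext s' (\<lambda>(u, v). F (gen (x * u, y * v))) p"
  by (simp add: rep_mult_def lin_ext_gen free.vector_space_axioms lin_ext_commute[OF assms] case_prod_unfold)

lemma rep_mult_gen: "rep_mult (gen (x, y)) (gen (x', y')) = gen (x * x', y * y')"
  by (simp add: rep_mult_def lin_ext_gen free.vector_space_axioms)

lemma rep_mult_assoc: "rep_mult (rep_mult p q) r = rep_mult p (rep_mult q r)"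
proof -
  have 1: "rep_mult (rep_mult (gen i) (gen j)) (gen k) = rep_mult (gen i) (rep_mult (gen j) (gen k))" for i j k
    by (cases i, cases j, cases k) (simp add: rep_mult_gen mult.assoc)
  have 2: "rep_mult (rep_mult (gen i) (gen j)) r = rep_mult (gen i) (rep_mult (gen j) r)" for i j
    by (rule lin_free_cong[where s = fscale and f = "\<lambda>r. rep_mult (rep_mult (gen i) (gen j)) r"]) (intro lin_intros | rule 1)+
  have 3: "rep_mult (rep_mult (gen i) q) r = rep_mult (gen i) (rep_mult q r)" for i
    by (rule lin_free_cong[where s = fscale and f = "\<lambda>q. rep_mult (rep_mult (gen i) q) r"]) (intro lin_intros | rule 2)+
  show ?thesis
    by (rule lin_free_cong[where s = fscale and f = "\<lambda>p. rep_mult (rep_mult p q) r"]) (intro lin_intros | rule 3)+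
qed

lemma rep_mult_one: "rep_mult p (gen (1, 1)) = p"
  by (rule lin_free_cong[where s = fscale and f = "\<lambda>p. rep_mult p (gen (1, 1))"])
    (intro lin_intros, intro lin_intros, simp add: rep_mult_gen split_paired_all)

lemma bilin_zero:
  assumes "lin fscale s' F" "\<And>y. lin s s' (\<lambda>x. F (gen (x, y)))" "\<And>x. lin s s' (\<lambda>y. F (gen (x, y)))"
    and "p \<in> N"
  shows "F p = 0"
  using bilin_ext_zero[OF assms(2-4)] lin_free_eq[OF assms(1), of p]
  by (simp add: case_prod_unfold)

lemmas lin_qprN = lin_qpr[OF subspace_tensor_rel[of s s]]
lemmas qprN_eq_0 = qpr_eq_0[OF subspace_tensor_rel[of s s]]
lemmas qprN_eq_iff = qpr_eq_iff[OF subspace_tensor_rel[of s s]]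

lemma
  assumes "lin fscale s' F" "\<And>p. p \<in> N \<Longrightarrow> F p = 0"
  shows lin_gen_left: "lin s s' (\<lambda>x. F (gen (x, y)))"
    and lin_gen_right: "lin s s' (\<lambda>y. F (gen (x, y)))"
proof -
  note F = lin_diff[OF assms(1)] lin_scale[OF assms(1)]
  have r: "r \<in> bilin_rels s s \<Longrightarrow> F r = 0" for r
    by (rule assms(2)) (simp add: tensor_rel_def free.span_base)
  have 1: "F (gen (x + x', y)) - F (gen (x, y)) - F (gen (x', y)) = 0" for x x' y
    unfolding F[symmetric] by (rule r) (unfold bilin_rels_def, blast)
  have 2: "F (gen (x, y + y')) - F (gen (x, y)) - F (gen (x, y')) = 0" for x y' y
    unfolding F[symmetric] by (rule r) (unfold bilin_rels_def, blast)
  have 3: "F (gen (s c x, y)) - s' c (F (gen (x, y))) = 0" for x c y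
    unfolding F[symmetric] by (rule r) (unfold bilin_rels_def, blast)
  have 4: "F (gen (x, s c y)) - s' c (F (gen (x, y))) = 0" for x c y
    unfolding F[symmetric] by (rule r) (unfold bilin_rels_def, blast)
  show "lin s s' (\<lambda>x. F (gen (x, y)))" "lin s s' (\<lambda>y. F (gen (x, y)))"
    using 1 2 3 4
    by (auto intro!: linI vector_space_axioms lin_vs2[OF assms(1)] simp: algebra_simps)
qed

lemma lin_tN_left: "lin s fscale (\<lambda>x. tN x y)" and lin_tN_right: "lin s fscale (tN x)"
  unfolding tN_def[abs_def]
  by (rule lin_gen_left lin_gen_right; simp add: lin_qprN qprN_eq_0)+

lemmas lin_tN_comp [lin_intros] = lin_comp[OF lin_tN_left] lin_comp[OF lin_tN_right]

lemma rep_mult_tensor_rel: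
  assumes "n \<in> N" shows "rep_mult p n \<in> N" "rep_mult n p \<in> N"
proof -
  have "qpr N (rep_mult p n) = 0"
    by (rule bilin_zero[OF _ _ _ assms, where s' = fscale and F = "\<lambda>n. qpr N (rep_mult p n)"])
      (unfold lin_rep_mult_gen_right[OF lin_qprN] case_prod_unfold tN_def[symmetric],
        (intro lin_intros lin_comp[OF lin_qprN])+)
  then show "rep_mult p n \<in> N" by (simp add: qprN_eq_0)
  have "qpr N (rep_mult n p) = 0"
    by (rule bilin_zero[OF _ _ _ assms, where s' = fscale and F = "\<lambda>n. qpr N (rep_mult n p)"])
      (unfold lin_rep_mult_gen_left[OF lin_qprN] case_prod_unfold tN_def[symmetric],
        (intro lin_intros lin_comp[OF lin_qprN])+)
  then show "rep_mult n p \<in> N" by (simp add: qprN_eq_0)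
qed

lemma tmult_tcls: "tmult s s (*) (*) (tcls s s p) (tcls s s q) = tcls s s (rep_mult p q)"
proof -
  define p' q' where "p' = rep (tcls s s p)" "q' = rep (tcls s s q)"
  have "p' - p \<in> N" "q' - q \<in> N"
    by (simp_all add: p'_q'_def rep_qcls subspace_tensor_rel)
  then have "rep_mult (p' - p) q' + rep_mult p (q' - q) \<in> N"
    by (intro free.subspace_add[OF subspace_tensor_rel] rep_mult_tensor_rel)
  then have "rep_mult p' q' - rep_mult p q \<in> N" by (simp add: rep_mult_left rep_mult_right)
  moreover have "tmult s s (*) (*) (tcls s s p) (tcls s s q) = tcls s s (rep_mult p' q')"
    by (simp add: tmult_def lift_def rep_mult_def p'_q'_def)
  ultimately show ?thesis by (simp add: qcls_eq_iff[OF subspace_tensor_rel])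
qed

text \<open>The preimage among formal sums. Subspaces, subalgebras and ideals of the tensor square
  correspond to those of the monoid algebra that contain \<open>N\<close>.\<close>

definition reps :: "('a \<times> 'a \<Rightarrow>\<^sub>0 'k) set set \<Rightarrow> ('a \<times> 'a \<Rightarrow>\<^sub>0 'k) set" where
  "reps B = {p. tcls s s p \<in> B}"

lemma reps_image: "N \<subseteq> J \<Longrightarrow> free.subspace J \<Longrightarrow> reps (tcls s s ` J) = J"
proof (intro set_eqI iffI)
  fix p assume J: "N \<subseteq> J" "free.subspace J" and "p \<in> reps (tcls s s ` J)"
  then obtain q where "q \<in> J" "p - q \<in> N"
    by (auto simp: reps_def qcls_eq_iff[OF subspace_tensor_rel])
  then show "p \<in> J" using J free.subspace_add[OF J(2), of q "p - q"] by auto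
qed (auto simp: reps_def)

lemma image_reps: "B \<subseteq> tensor s s \<Longrightarrow> tcls s s ` reps B = B"
  by (auto simp: reps_def)

lemma ball_reps: "B \<subseteq> tensor s s \<Longrightarrow> (\<forall>P\<in>B. R P) \<longleftrightarrow> (\<forall>p\<in>reps B. R (tcls s s p))"
  by (subst image_reps[symmetric]) auto

section \<open>Subspaces, subalgebras and ideals in terms of representatives\<close>

lemma tensor_subspace_iff:
  "tensor_subspace s B \<longleftrightarrow> B \<subseteq> tensor s s \<and> free.subspace (reps B)"
proof (cases "B \<subseteq> tensor s s")
  case True
  then show ?thesis
    unfolding tensor_subspace_def free.subspace_def
    by (simp add: ball_reps qadd_qcls subspace_tensor_rel qscale_qcls) (auto simp: reps_def)
qed (simp add: tensor_subspace_def)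

lemma rel_subset_reps: "tensor_subspace s B \<Longrightarrow> N \<subseteq> reps B"
  unfolding tensor_subspace_def reps_def
  by (auto simp: qcls_eq_iff[OF subspace_tensor_rel, of s s _ 0, symmetric, simplified])

lemma tensor_subalgebra_iff:
  "tensor_subalgebra s B \<longleftrightarrow> B \<subseteq> tensor s s \<and> free.subspace (reps B) \<and>
     (\<forall>p\<in>reps B. \<forall>q\<in>reps B. rep_mult p q \<in> reps B)"
proof (cases "B \<subseteq> tensor s s")
  case True
  then show ?thesis
    unfolding tensor_subalgebra_def tensor_subspace_iff
    by (simp add: ball_reps tmult_tcls) (auto simp: reps_def)
qed (simp add: tensor_subalgebra_def tensor_subspace_def)

lemma tensor_ideal_iff:
  assumes "B \<subseteq> tensor s s"
  shows "tensor_ideal s B J \<longleftrightarrow> free.subspace (reps J) \<and> J \<subseteq> B \<and>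
     (\<forall>p\<in>reps B. \<forall>q\<in>reps J. rep_mult p q \<in> reps J \<and> rep_mult q p \<in> reps J)"
proof (cases "J \<subseteq> B")
  case True
  then have "J \<subseteq> tensor s s" using assms by blast
  then show ?thesis
    using assms unfolding tensor_ideal_def tensor_subspace_iff
    by (simp add: ball_reps tmult_tcls) (auto simp: reps_def)
qed (simp add: tensor_ideal_def)

end

text \<open>An empty intersection would be \<open>UNIV\<close>, which is not a set of cosets; the
  member \<open>T\<close> keeps the family nonempty.\<close>

lemma hull_in_nonempty:
  assumes "P T" "X \<subseteq> T" "\<And>\<T>. \<T> \<noteq> {} \<Longrightarrow> (\<And>T. T \<in> \<T> \<Longrightarrow> P T) \<Longrightarrow> P (\<Inter>\<T>)"
  shows "P (P hull X)"
  unfolding hull_def by (rule assms(3)) (use assms(1,2) in auto)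

context k_algebra
begin

section \<open>Generated subalgebras and ideals\<close>

lemma tensor_subspace_Inter:
  assumes "\<T> \<noteq> {}" "\<And>T. T \<in> \<T> \<Longrightarrow> tensor_subspace s T"
  shows "tensor_subspace s (\<Inter>\<T>)"
  using assms unfolding tensor_subspace_def by blast

lemma tensor_subalgebra_hull:
  assumes "X \<subseteq> tensor s s" shows "tensor_subalgebra s (tensor_subalgebra s hull X)"
proof (rule hull_in_nonempty[where T = "tensor s s"])
  show "tensor_subalgebra s (tensor s s)"
    unfolding tensor_subalgebra_iff by (simp add: reps_def free.subspace_def)
  show "tensor_subalgebra s (\<Inter>\<T>)" if "\<T> \<noteq> {}" "\<And>T. T \<in> \<T> \<Longrightarrow> tensor_subalgebra s T" for \<T>
    using that tensor_subspace_Inter[of \<T>] unfolding tensor_subalgebra_def by blast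
qed fact

lemma tensor_ideal_hull:
  assumes "tensor_subalgebra s B" "X \<subseteq> B" shows "tensor_ideal s B (tensor_ideal s B hull X)"
proof (rule hull_in_nonempty[where T = B])
  show "tensor_ideal s B B"
    using assms(1) unfolding tensor_subalgebra_def tensor_ideal_def by blast
  show "tensor_ideal s B (\<Inter>\<T>)" if "\<T> \<noteq> {}" "\<And>T. T \<in> \<T> \<Longrightarrow> tensor_ideal s B T" for \<T>
    using that tensor_subspace_Inter[of \<T>] unfolding tensor_ideal_def by blast
qed fact

lemma reps_subalgebra_hull:
  assumes "free.subspace J" "N \<subseteq> J" "\<And>p q. p \<in> J \<Longrightarrow> q \<in> J \<Longrightarrow> rep_mult p q \<in> J" "X \<subseteq> tcls s s ` J"
  shows "reps (tensor_subalgebra s hull X) \<subseteq> J"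
proof -
  have "tensor_subalgebra s (tcls s s ` J)"
    using assms(1,3) unfolding tensor_subalgebra_iff reps_image[OF assms(2,1)] by auto
  with assms(4) have "tensor_subalgebra s hull X \<subseteq> tcls s s ` J" by (rule hull_minimal)
  then have "reps (tensor_subalgebra s hull X) \<subseteq> reps (tcls s s ` J)" by (auto simp: reps_def)
  then show ?thesis unfolding reps_image[OF assms(2,1)] .
qed

lemma reps_ideal_hull:
  assumes "free.subspace J" "N \<subseteq> J" "J \<subseteq> reps B" "B \<subseteq> tensor s s"
    and "\<And>p q. p \<in> reps B \<Longrightarrow> q \<in> J \<Longrightarrow> rep_mult p q \<in> J \<and> rep_mult q p \<in> J" "X \<subseteq> tcls s s ` J"
  shows "reps (tensor_ideal s B hull X) \<subseteq> J"
proof -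
  have "tensor_ideal s B (tcls s s ` J)"
    using assms(1,3,5) unfolding tensor_ideal_iff[OF assms(4)] reps_image[OF assms(2,1)]
    by (auto simp: reps_def)
  with assms(6) have "tensor_ideal s B hull X \<subseteq> tcls s s ` J" by (rule hull_minimal)
  then have "reps (tensor_ideal s B hull X) \<subseteq> reps (tcls s s ` J)" by (auto simp: reps_def)
  then show ?thesis unfolding reps_image[OF assms(2,1)] .
qed

end

section \<open>The balancing subalgebra\<close>

context scalar_extension
begin

abbreviation I :: "('h \<times> 'h \<Rightarrow>\<^sub>0 'k) set" where "I \<equiv> balanced_rel sH (lact al) (ract be)"

definition tI :: "'h \<Rightarrow> 'h \<Rightarrow> ('h \<times> 'h \<Rightarrow>\<^sub>0 'k)" where "tI x y = qpr I (gen (x, y))"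

lemmas subspace_I = subspace_balanced_rel[of sH "lact al" "ract be"]
lemmas lin_qprI = lin_qpr[OF subspace_I]
lemmas qprI_eq_0 = qpr_eq_0[OF subspace_I]
lemmas subspace_N = subspace_tensor_rel[of sH sH]

lemma N_subset_I: "H.N \<subseteq> I"
  unfolding tensor_rel_def balanced_rel_def by (rule free.span_mono) blast

lemma lin_tI_left: "lin sH fscale (\<lambda>x. tI x y)" and lin_tI_right: "lin sH fscale (tI x)"
  unfolding tI_def[abs_def]
  by (rule H.lin_gen_left H.lin_gen_right; use N_subset_I in \<open>auto simp: lin_qprI qprI_eq_0\<close>)+

lemmas lin_tI_comp [lin_intros] = lin_comp[OF lin_tI_left] lin_comp[OF lin_tI_right]

lemma tI_balanced: "tI (be a * x) y = tI x (al a * y)"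
proof -
  have "gen (be a * x, y) - gen (x, al a * y) \<in> I"
    unfolding balanced_rel_def by (rule free.span_base) (auto simp: lact_def ract_def)
  then show ?thesis by (simp add: tI_def qpr_eq_iff[OF subspace_I])
qed

lemma balanced_ext_zero:
  assumes "\<And>y. lin sH s (\<lambda>x. f x y)" "\<And>x. lin sH s (f x)"
    and "\<And>a x y. f (be a * x) y = f x (al a * y)" "p \<in> I"
  shows "lin_ext s (\<lambda>(x, y). f x y) p = 0"
  using assms(4) unfolding balanced_rel_def
proof (rule lin_ext_span_zero[OF lin_vs2[OF assms(2)], rotated])
  note ex = lin_ext_expand[OF lin_vs2[OF assms(2)]]
  fix r assume r: "r \<in> bilin_rels sH sH \<union> {gen (ract be x a, y) - gen (x, lact al a y) |a x y. True}"
  then show "lin_ext s (\<lambda>(x, y). f x y) r = 0"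
  proof
    assume "r \<in> bilin_rels sH sH"
    then show ?thesis by (intro bilin_ext_zero[OF assms(1,2)]) (simp add: tensor_rel_def free.span_base)
  qed (auto simp: ex lact_def ract_def assms(3))
qed

lemma balanced_zero:
  assumes "lin fscale s F" "\<And>y. lin sH s (\<lambda>x. F (gen (x, y)))" "\<And>x. lin sH s (\<lambda>y. F (gen (x, y)))"
    and "\<And>a x y. F (gen (be a * x, y)) = F (gen (x, al a * y))" "p \<in> I"
  shows "F p = 0"
  using balanced_ext_zero[OF assms(2-5)] lin_free_eq[OF assms(1), of p]
  by (simp add: case_prod_unfold)

text \<open>The balancing relations involve multiplication from the left only, so multiplying from
  the right preserves them.\<close>

lemma I_right_ideal: assumes "n \<in> I" shows "H.rep_mult n q \<in> I"
proof -
  have "qpr I (H.rep_mult n q) = 0"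
    by (rule balanced_zero[OF _ _ _ _ assms, where s = fscale and F = "\<lambda>n. qpr I (H.rep_mult n q)"])
      (unfold H.lin_rep_mult_gen_left[OF lin_qprI] case_prod_unfold tI_def[symmetric],
        (intro lin_intros lin_comp[OF lin_qprI] | simp add: mult.assoc tI_balanced)+)
  then show ?thesis by (simp add: qprI_eq_0)
qed

subsection \<open>Generators\<close>

definition source_gen :: "'a \<Rightarrow> ('h \<times> 'h \<Rightarrow>\<^sub>0 'k)" where "source_gen a = gen (al a, 1)"
definition twist_gen :: "'a \<Rightarrow> ('h \<times> 'h \<Rightarrow>\<^sub>0 'k)" where "twist_gen a = twist sharp S rho a"
definition comult_gen :: "'t \<Rightarrow> ('h \<times> 'h \<Rightarrow>\<^sub>0 'k)" where
  "comult_gen t = lift fscale (\<lambda>t1 t2. gen (io t1, io t2)) (Dl t)"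

abbreviation B where "B \<equiv> balancing sH sharp Dl S rho"
abbreviation Bplus where "Bplus \<equiv> balancing_plus sH sharp Dl S rho"
abbreviation B_reps where "B_reps \<equiv> H.reps B"

lemma B_eq: "B = tensor_subalgebra sH hull
    (range (\<lambda>a. tcls sH sH (source_gen a)) \<union> range (\<lambda>a. tcls sH sH (twist_gen a)) \<union> range (\<lambda>t. tcls sH sH (comult_gen t)))"
  by (simp only: balancing_def source_gen_def twist_gen_def comult_gen_def io_def ext_alpha_def simp_thms full_SetCompr_eq)

lemma Bplus_eq: "Bplus = tensor_ideal sH B hull (range (\<lambda>a. tcls sH sH (source_gen a - twist_gen a)))"
  by (simp only: balancing_plus_def source_gen_def twist_gen_def ext_alpha_def simp_thms full_SetCompr_eq)

lemma B_subalgebra: "tensor_subalgebra sH B"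
  unfolding B_eq by (rule H.tensor_subalgebra_hull) auto

lemma B_subset: "B \<subseteq> tensor sH sH"
  using B_subalgebra unfolding H.tensor_subalgebra_iff by blast

lemma subspace_B_reps: "free.subspace B_reps" and B_reps_mult: "p \<in> B_reps \<Longrightarrow> q \<in> B_reps \<Longrightarrow> H.rep_mult p q \<in> B_reps"
  using B_subalgebra unfolding H.tensor_subalgebra_iff by blast+

lemma N_subset_B_reps: "H.N \<subseteq> B_reps"
  using B_subalgebra unfolding tensor_subalgebra_def by (intro H.rel_subset_reps) blast

lemma gens_B_reps: "source_gen a \<in> B_reps" "twist_gen a \<in> B_reps" "comult_gen t \<in> B_reps"
  using hull_subset[of _ "tensor_subalgebra sH"] unfolding H.reps_def B_eq mem_Collect_eq
  by (auto intro!: subsetD[OF hull_subset])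

text \<open>Used with \<open>J\<close> the set of elements having a property stable under sums,
  scalars and products.\<close>

lemma B_reps_induct:
  assumes "free.subspace J" "H.N \<subseteq> J" "\<And>p q. p \<in> J \<Longrightarrow> q \<in> J \<Longrightarrow> H.rep_mult p q \<in> J"
    and "\<And>a. source_gen a \<in> J" "\<And>a. twist_gen a \<in> J" "\<And>t. comult_gen t \<in> J"
  shows "B_reps \<subseteq> J"
  unfolding B_eq by (rule H.reps_subalgebra_hull[OF assms(1-3)]) (use assms(4-6) in auto)

lemma lin_twist_gen: "lin fscale s F \<Longrightarrow> F (H.rep_mult (twist_gen a) q) = cw s a (\<lambda>a0 a1. F (H.rep_mult (gen (io (S a1), al a0)) q))"
  and lin_comult_gen: "lin fscale s F \<Longrightarrow> F (H.rep_mult (comult_gen t) q) = sw s t (\<lambda>t1 t2. F (H.rep_mult (gen (io t1, io t2)) q))"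
  by (simp_all add: twist_gen_def twist_def comult_gen_def lift_commute[OF lin_comp[OF _ H.lin_rep_mult_left]] flip: io_def ext_alpha_def)

subsection \<open>The coproduct on representatives\<close>

text \<open>The formal sum inside \<open>ext_comult\<close>, before its coset is taken. It involves
  chosen representatives, so linearity and multiplicativity are claimed only modulo
  \<open>N\<close>.\<close>

definition E :: "'h \<Rightarrow> ('h \<times> 'h \<Rightarrow>\<^sub>0 'k)" where
  "E h = lift fscale (\<lambda>a t. lift fscale (\<lambda>t1 t2. gen (sharp a t1, sharp 1 t2)) (Dl t)) (as_tensor sH sharp h)"

lemma
  assumes "lin fscale s F" "\<And>y. lin sH s (\<lambda>x. F (gen (x, y)))" "\<And>x. lin sH s (\<lambda>y. F (gen (x, y)))"
  shows lin_E: "lin sH s (\<lambda>h. F (E h))"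
    and E_sharp: "F (E (al a * io t)) = sw s t (\<lambda>t1 t2. F (gen (al a * io t1, io t2)))"
proof -
  note f = lin_comp[OF assms(2)] lin_comp[OF assms(3)]
  have *: "F (E h) = hl s (\<lambda>a t. sw s t (\<lambda>t1 t2. F (gen (al a * io t1, io t2)))) h" for h
    by (simp add: E_def lift_commute[OF assms(1)] sharp_eq al_one)
  show "lin sH s (\<lambda>h. F (E h))"
    unfolding * by (rule lin_hl; intro lin_intros f lin_vs2[OF assms(1)])
  show "F (E (al a * io t)) = sw s t (\<lambda>t1 t2. F (gen (al a * io t1, io t2)))"
    unfolding * by (rule hl_sharp; intro lin_intros f lin_vs2[OF assms(1)])
qed

lemma lin_qprN_E: "lin sH fscale (\<lambda>h. qpr H.N (E h))"
  and qprN_E_sharp: "qpr H.N (E (al a * io t)) = sw fscale t (\<lambda>t1 t2. H.tN (al a * io t1) (io t2))"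
  unfolding H.tN_def
  by (rule lin_E E_sharp; intro H.lin_qprN H.lin_tN_left[unfolded H.tN_def] H.lin_tN_right[unfolded H.tN_def])+

lemmas lin_qprN_E_comp [lin_intros] = lin_comp[OF lin_qprN_E]

lemma E_al: "H.tN (al a) 1 = qpr H.N (E (al a))"
proof -
  have "qpr H.N (E (al a * io 1)) = H.tN (al a * io 1) (io 1)"
    by (subst qprN_E_sharp, subst sw_one) (intro lin_intros | rule refl)+
  then show ?thesis by (simp add: io_one)
qed

lemma E_io: "qpr H.N (comult_gen t) = qpr H.N (E (io t))"
  using qprN_E_sharp[of 1 t] by (simp add: al_one comult_gen_def lift_commute[OF H.lin_qprN] flip: H.tN_def)

text \<open>Only the first tensor factor carries elements of A, so straightening the product affects
  that factor alone; coassociativity and multiplicativity of \<Delta>_T do the rest.\<close>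

lemma E_mult_mod: "H.rep_mult (E h) (E h') - E (h * h') \<in> H.N"
proof -
  have lE: "lin sH fscale (\<lambda>h. qpr H.N (H.rep_mult (E h) q))" "lin sH fscale (\<lambda>h. qpr H.N (H.rep_mult q (E h)))" for q
  proof -
    show "lin sH fscale (\<lambda>h. qpr H.N (H.rep_mult (E h) q))"
      by (rule lin_E) (unfold H.lin_rep_mult_gen_left[OF H.lin_qprN] case_prod_unfold H.tN_def[symmetric],
          (intro lin_intros lin_comp[OF H.lin_qprN])+)
    show "lin sH fscale (\<lambda>h. qpr H.N (H.rep_mult q (E h)))"
      by (rule lin_E) (unfold H.lin_rep_mult_gen_right[OF H.lin_qprN] case_prod_unfold H.tN_def[symmetric],
          (intro lin_intros lin_comp[OF H.lin_qprN])+)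
  qed
  have E1: "qpr H.N (H.rep_mult (E (al a * io t)) q) = sw fscale t (\<lambda>t1 t2. qpr H.N (H.rep_mult (gen (al a * io t1, io t2)) q))" for a t q
    by (rule E_sharp[where F = "\<lambda>p. qpr H.N (H.rep_mult p q)"])
      (unfold H.lin_rep_mult_gen_left[OF H.lin_qprN] case_prod_unfold H.tN_def[symmetric],
          (intro lin_intros lin_comp[OF H.lin_qprN])+)
  have E2: "qpr H.N (H.rep_mult (gen (u, v)) (E (al a * io t))) = sw fscale t (\<lambda>t1 t2. H.tN (u * (al a * io t1)) (v * io t2))" for a t u v
  proof -
    have "qpr H.N (H.rep_mult (gen (u, v)) (E (al a * io t))) =
        sw fscale t (\<lambda>t1 t2. qpr H.N (H.rep_mult (gen (u, v)) (gen (al a * io t1, io t2))))"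
      by (rule E_sharp[where F = "\<lambda>p. qpr H.N (H.rep_mult (gen (u, v)) p)"])
        (unfold H.rep_mult_gen H.tN_def[symmetric], (intro lin_intros lin_comp[OF H.lin_qprN])+)
    then show ?thesis by (simp only: H.rep_mult_gen H.tN_def)
  qed
  have 1: "qpr H.N (H.rep_mult (E (al a * io t)) (E (al a' * io t'))) = qpr H.N (E (al a * io t * (al a' * io t')))"
    for a t a' t'
  proof -
    let ?f = "\<lambda>x y t2 s1 s2. H.tN (al (a * act x a') * io (y * s1)) (io (t2 * s2))"
    have "qpr H.N (H.rep_mult (E (al a * io t)) (E (al a' * io t'))) =
      sw fscale t (\<lambda>t1 t2. sw fscale t' (\<lambda>s1 s2. sw fscale t1 (\<lambda>x y. ?f x y t2 s1 s2)))"
      unfolding E1 E2 sharp_mult_sharp io_mult[symmetric] lift_commute[OF H.lin_tN_left] ..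
    also have "\<dots> = sw fscale t (\<lambda>t1 t2. sw fscale t1 (\<lambda>x y. sw fscale t' (\<lambda>s1 s2. ?f x y t2 s1 s2)))"
      by (subst lift_swap[OF free.vector_space_axioms]) (rule refl)
    also have "\<dots> = sw fscale t (\<lambda>x r. sw fscale r (\<lambda>y t2. sw fscale t' (\<lambda>s1 s2. ?f x y t2 s1 s2)))"
      by (subst sw_coassoc) (intro lin_intros | rule refl)+
    also have "\<dots> = sw fscale t (\<lambda>x r. sw fscale (r * t') (\<lambda>u v. H.tN (al (a * act x a') * io u) (io v)))"
      by (subst sw_mult) (intro lin_intros | rule refl)+
    also have "\<dots> = qpr H.N (E (al a * io t * (al a' * io t')))"
      by (simp only: sharp_mult_sharp lift_commute[OF lin_qprN_E] qprN_E_sharp)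
    finally show ?thesis .
  qed
  have 2: "qpr H.N (H.rep_mult (E (al a * io t)) (E h')) = qpr H.N (E (al a * io t * h'))" for a t
    by (rule smash_linear_eqI[where s = fscale and F = "\<lambda>h'. qpr H.N (H.rep_mult (E (al a * io t)) (E h'))"])
      (intro lin_intros lE | rule 1)+
  have "qpr H.N (H.rep_mult (E h) (E h')) = qpr H.N (E (h * h'))"
    by (rule smash_linear_eqI[where s = fscale and F = "\<lambda>h. qpr H.N (H.rep_mult (E h) (E h'))"])
      (intro lin_intros lE | rule 2)+
  then show ?thesis by (simp add: H.qprN_eq_iff)
qed

lemma E_mod: "source_gen a - E (al a) \<in> H.N" "comult_gen t - E (io t) \<in> H.N"
  using E_al[of a] E_io[of t] by (simp_all add: source_gen_def H.tN_def H.qprN_eq_iff)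

lemma mod_N: "p - q \<in> H.N \<Longrightarrow> H.N \<subseteq> J \<Longrightarrow> free.subspace J \<Longrightarrow> p \<in> J \<longleftrightarrow> q \<in> J"
  using free.subspace_add[of J "p - q" q] free.subspace_diff[of J p "p - q"] by auto

lemma E_B_reps: "E h \<in> B_reps"
proof -
  note l = lin_qpr[OF subspace_B_reps]
  have z: "p \<in> H.N \<Longrightarrow> qpr B_reps p = 0" for p
    using N_subset_B_reps qpr_eq_0[OF subspace_B_reps] by blast
  have 1: "E (al a * io t) \<in> B_reps" for a t
  proof -
    have "H.rep_mult (source_gen a) (comult_gen t) - H.rep_mult (E (al a)) (E (io t)) =
      H.rep_mult (source_gen a - E (al a)) (comult_gen t) + H.rep_mult (E (al a)) (comult_gen t - E (io t))"
      by (simp add: H.rep_mult_left H.rep_mult_right)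
    also have "\<dots> \<in> H.N"
      by (intro free.subspace_add[OF subspace_N] H.rep_mult_tensor_rel E_mod)
    finally have "H.rep_mult (E (al a)) (E (io t)) \<in> B_reps"
      using mod_N[OF _ N_subset_B_reps subspace_B_reps] B_reps_mult gens_B_reps by blast
    then show ?thesis
      using mod_N[OF E_mult_mod N_subset_B_reps subspace_B_reps] by blast
  qed
  \<comment> \<open>Membership is restated as vanishing of a linear map with kernel
    \<open>B_reps\<close>, and can therefore be checked on elements a # t.\<close>
  have "qpr B_reps (E h) = 0"
  proof (rule smash_linear_eqI[where s = fscale and F = "\<lambda>h. qpr B_reps (E h)" and G = "\<lambda>h. 0"])
    show "lin sH fscale (\<lambda>h. qpr B_reps (E h))"
      by (rule lin_E[OF l]) (rule H.lin_gen_left[OF l z] H.lin_gen_right[OF l z]; assumption)+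
    show "lin sH fscale (\<lambda>h. 0 :: 'h \<times> 'h \<Rightarrow>\<^sub>0 'k)"
      by (rule linI) (auto intro: lin_intros)
  qed (simp add: 1 qpr_eq_0[OF subspace_B_reps])
  then show ?thesis by (simp add: qpr_eq_0[OF subspace_B_reps])
qed

subsection \<open>The kernel is stable under left multiplication by the subalgebra\<close>

lemma qprI_source_gen: "qpr I (H.rep_mult (source_gen a) (gen (x, y))) = tI (al a * x) y"
  by (simp add: source_gen_def H.rep_mult_gen tI_def)

text \<open>The factor a0 crosses the balanced tensor sign and becomes \<beta>(a0) on the left,
  where \<open>cw_be_antipode\<close> applies.\<close>

lemma qprI_twist_gen: "qpr I (H.rep_mult (twist_gen a) (gen (x, y))) = tI (al a * x) y"
proof -
  have "qpr I (H.rep_mult (twist_gen a) (gen (x, y))) = cw fscale a (\<lambda>a0 a1. tI (be a0 * io (S a1) * x) y)"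
    by (simp add: lin_twist_gen[OF lin_qprI] H.rep_mult_gen mult.assoc tI_balanced flip: tI_def)
  also have "\<dots> = tI (al a * x) y"
    using lift_commute[of sH fscale "\<lambda>z. tI (z * x) y" "\<lambda>a0 a1. be a0 * io (S a1)" "rho a"]
    by (simp add: cw_be_antipode lin_intros)
  finally show ?thesis .
qed

lemma twist_source_gen_I: "twist_gen a - source_gen a \<in> I"
  using qprI_twist_gen[of a 1 1] qprI_source_gen[of a 1 1] by (simp add: H.rep_mult_one flip: qpr_eq_iff[OF subspace_I])

lemma qprI_comult_gen: "qpr I (H.rep_mult (comult_gen t) (gen (x, y))) = sw fscale t (\<lambda>t1 t2. tI (io t1 * x) (io t2 * y))"
  by (simp add: lin_comult_gen[OF lin_qprI] H.rep_mult_gen flip: tI_def)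

lemma B_reps_I: assumes "p \<in> B_reps" "n \<in> I" shows "H.rep_mult p n \<in> I"
proof -
  let ?K = "{p. \<forall>n\<in>I. H.rep_mult p n \<in> I}"
  have "B_reps \<subseteq> ?K"
  proof (rule B_reps_induct)
    show "free.subspace ?K"
      by (auto simp: free.subspace_def H.rep_mult_left free.subspace_0[OF subspace_I] free.subspace_add[OF subspace_I]
          free.subspace_scale[OF subspace_I])
    show "H.N \<subseteq> ?K" using H.rep_mult_tensor_rel N_subset_I by blast
    show "H.rep_mult p q \<in> ?K" if "p \<in> ?K" "q \<in> ?K" for p q
      using that by (simp add: H.rep_mult_assoc)
    have K: "g \<in> ?K" if "\<And>n. n \<in> I \<Longrightarrow> qpr I (H.rep_mult g n) = 0" for g
      using that by (simp add: qprI_eq_0)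
    note l = lin_intros lin_comp[OF lin_qprI]
    show "source_gen a \<in> ?K" for a
      by (rule K, erule balanced_zero[where s = fscale and F = "\<lambda>n. qpr I (H.rep_mult (source_gen a) n)", rotated -1])
        (unfold qprI_source_gen, (intro l | simp only: tI_balanced[symmetric] mult.assoc[symmetric] be_al)+)
    show "twist_gen a \<in> ?K" for a
      by (rule K, erule balanced_zero[where s = fscale and F = "\<lambda>n. qpr I (H.rep_mult (twist_gen a) n)", rotated -1])
        (unfold qprI_twist_gen, (intro l | simp only: tI_balanced[symmetric] mult.assoc[symmetric] be_al)+)
    show "comult_gen t \<in> ?K" for t
    proof (rule K, erule balanced_zero[where s = fscale and F = "\<lambda>n. qpr I (H.rep_mult (comult_gen t) n)", rotated -1], goal_cases)
      case (4 _ a x y)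
      \<comment> \<open>\<open>io_be\<close> brings out \<beta> of a acted on by the middle leg of
        t. After crossing the tensor sign, the middle and last legs are exactly those of
        \<open>io_al\<close>.\<close>
      have "sw fscale t (\<lambda>t1 t2. tI (io t1 * (be a * x)) (io t2 * y)) =
          sw fscale t (\<lambda>t1 t2. sw fscale t1 (\<lambda>u v. tI (io u * x) (al (act v a) * (io t2 * y))))"
      proof -
        have "io t1 * (be a * x) = sw sH t1 (\<lambda>u v. be (act v a) * (io u * x))" for t1
          by (simp only: mult.assoc[symmetric] io_be lift_mult_right)
        then show ?thesis by (simp only: lift_commute[OF lin_tI_left] tI_balanced)
      qed
      also have "\<dots> = sw fscale t (\<lambda>u r. sw fscale r (\<lambda>v t2. tI (io u * x) (al (act v a) * (io t2 * y))))"
        by (subst sw_coassoc) (intro lin_intros | rule refl)+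
      also have "\<dots> = sw fscale t (\<lambda>t1 t2. tI (io t1 * x) (io t2 * (al a * y)))"
        by (simp only: mult.assoc[symmetric] io_al lift_mult_right lift_commute[OF lin_tI_right])
      finally show ?case unfolding qprI_comult_gen .
    qed (unfold qprI_comult_gen, (intro l)+)
  qed
  with assms show ?thesis by blast
qed

subsection \<open>The map \<open>x \<otimes> y \<mapsto> x \<tau>(y)\<close>\<close>

definition phi :: "('h \<times> 'h \<Rightarrow>\<^sub>0 'k) \<Rightarrow> 'h" where
  "phi p = lin_ext sH (\<lambda>(x, y). x * ta y) p"

lemma lin_phi: "lin fscale sH phi"
  unfolding phi_def[abs_def] by (rule lin_lin_ext) (intro lin_intros)

lemma phi_gen: "phi (gen (x, y)) = x * ta y"
  by (simp add: phi_def lin_ext_gen H.vector_space_axioms)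

lemma phi_N: "p \<in> H.N \<Longrightarrow> phi p = 0"
  unfolding phi_def by (rule bilin_ext_zero; (assumption | intro lin_intros))

lemma lift_phi: "lift sH (\<lambda>x y. x * ta y) (tcls sH sH p) = phi p"
  unfolding phi_def by (rule lift_tcls) (intro lin_intros)+

lemmas phi_lin = lin_add[OF lin_phi] lin_diff[OF lin_phi] lin_scale[OF lin_phi] lin_zero[OF lin_phi]

text \<open>As \<tau> reverses products, a left factor wraps around the value of \<phi>. Hence
  \<phi>(p q) depends on q only through \<phi>(q).\<close>

lemma phi_gen_mult: "phi (H.rep_mult (gen (x, y)) q) = x * phi q * ta y"
proof (rule lin_free_cong[where s = sH and f = "\<lambda>q. phi (H.rep_mult (gen (x, y)) q)"])
  show "phi (H.rep_mult (gen (x, y)) (gen z)) = x * phi (gen z) * ta y" for z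
    by (cases z) (simp add: H.rep_mult_gen phi_gen ta_mult mult.assoc)
qed (intro lin_intros lin_comp[OF lin_phi])+

lemma phi_mult_zero: assumes "phi q = 0" shows "phi (H.rep_mult p q) = 0"
proof -
  have "phi (H.rep_mult p q) = lin_ext sH (\<lambda>x. phi (H.rep_mult (gen x) q)) p"
    by (rule lin_free_eq[where g = "\<lambda>p. phi (H.rep_mult p q)"]) (intro lin_intros lin_comp[OF lin_phi])
  also have "\<dots> = 0"
    by (simp add: lin_ext_def phi_gen_mult assms split_paired_all case_prod_unfold vs_simps[OF H.vector_space_axioms] flip: surjective_pairing)
  finally show ?thesis .
qed

lemma phi_source_gen: "phi (H.rep_mult (source_gen a) q) = al a * phi q"
  by (simp add: source_gen_def phi_gen_mult ta_one)

text \<open>The assumption that \<phi>(q) lies in A is what allows it to pass \<open>tA a0\<close>,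
  leaving \<open>cw_antipode_tA\<close>.\<close>

lemma phi_twist_gen: assumes "phi q = al c" shows "phi (H.rep_mult (twist_gen a) q) = al a * al c"
proof -
  have "phi (H.rep_mult (twist_gen a) q) = cw sH a (\<lambda>a0 a1. io (S a1) * tA a0 * al c)"
    by (simp add: lin_twist_gen[OF lin_phi] phi_gen_mult assms ta_al mult.assoc al_tA)
  then show ?thesis by (simp add: cw_antipode_tA flip: lift_mult_right)
qed

lemma phi_comult_gen: assumes "phi q = al c" shows "phi (H.rep_mult (comult_gen t) q) = al (act t c)"
proof -
  have "phi (H.rep_mult (comult_gen t) q) = sw sH t (\<lambda>t1 t2. sw sH t1 (\<lambda>x y. al (act x c) * io (y * S t2)))"
    by (simp add: lin_comult_gen[OF lin_phi] phi_gen_mult assms ta_io io_al lift_mult_right io_mult mult.assoc)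
  also have "\<dots> = sw sH t (\<lambda>x r. sw sH r (\<lambda>y t2. al (act x c) * io (y * S t2)))"
    by (subst sw_coassoc) (intro lin_intros | rule refl)+
  also have "\<dots> = al (act t c)"
    using sw_antipode_right[of sH "\<lambda>z. al (act x c) * io z" for x]
    by (intro sw_collapse_right[where k = "\<lambda>x. al (act x c)"]) (simp_all add: lin_intros io_one)
  finally show ?thesis .
qed

lemma phi_B_reps: assumes "p \<in> B_reps" shows "phi p \<in> range al"
proof -
  \<comment> \<open>Having \<phi>(p) in A is not visibly stable under products; preserving A under
    left multiplication is. Applying this to q = 1 gives the claim.\<close>
  let ?V = "{p. \<forall>q. phi q \<in> range al \<longrightarrow> phi (H.rep_mult p q) \<in> range al}"
  have r0: "0 \<in> range al" by (rule range_eqI[of _ _ 0]) (simp add: lin_zero[OF lin_al])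
  have radd: "x + y \<in> range al" if "x \<in> range al" "y \<in> range al" for x y
    using that by (auto simp flip: lin_add[OF lin_al])
  have rsc: "sH c x \<in> range al" if "x \<in> range al" for c x
    using that by (auto simp flip: lin_scale[OF lin_al])
  have "B_reps \<subseteq> ?V"
  proof (rule B_reps_induct)
    show "free.subspace ?V"
      by (auto simp: free.subspace_def H.rep_mult_left phi_lin r0 radd rsc)
    show "H.N \<subseteq> ?V" using H.rep_mult_tensor_rel phi_N r0 by auto
    show "H.rep_mult p q \<in> ?V" if "p \<in> ?V" "q \<in> ?V" for p q
      using that by (simp add: H.rep_mult_assoc)
    show "source_gen a \<in> ?V" "twist_gen a \<in> ?V" "comult_gen t \<in> ?V" for a t
      by (auto simp: phi_source_gen phi_twist_gen phi_comult_gen simp flip: al_mult)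
  qed
  moreover have "phi (gen (1, 1)) \<in> range al"
    by (rule range_eqI[of _ _ 1]) (simp add: phi_gen ta_one al_one)
  ultimately have "phi (H.rep_mult p (gen (1, 1))) \<in> range al" using assms by blast
  then show ?thesis by (simp add: H.rep_mult_one)
qed

subsection \<open>Decomposition of the subalgebra\<close>

text \<open>This ideal contains \<open>\<B>\<^sup>+\<close>, and it turns out to be all of \<open>I\<^sub>A \<inter> \<B>\<close>.\<close>

definition Z :: "('h \<times> 'h \<Rightarrow>\<^sub>0 'k) set" where
  "Z = {z \<in> B_reps \<inter> I. \<forall>q\<in>B_reps. phi (H.rep_mult z q) = 0}"

lemma subspace_Z: "free.subspace Z"
  using subspace_B_reps subspace_I unfolding Z_def free.subspace_def
  by (auto simp: H.rep_mult_left phi_lin vs_simps[OF H.vector_space_axioms])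

lemma N_subset_Z: "H.N \<subseteq> Z"
  using N_subset_B_reps N_subset_I H.rep_mult_tensor_rel phi_N by (auto simp: Z_def)

text \<open>The quantifier over q in \<open>Z\<close> absorbs right multiplication; left
  multiplication uses stability of I_A under B and that the kernel of \<phi> is a left
  ideal.\<close>

lemma Z_ideal: "p \<in> B_reps \<Longrightarrow> z \<in> Z \<Longrightarrow> H.rep_mult p z \<in> Z" "p \<in> B_reps \<Longrightarrow> z \<in> Z \<Longrightarrow> H.rep_mult z p \<in> Z"
  by (auto simp: Z_def B_reps_mult B_reps_I I_right_ideal H.rep_mult_assoc phi_mult_zero)

text \<open>For q in B the value \<phi>(q) lies in A, and there both generators act as
  multiplication by \<alpha>(a).\<close>

lemma twist_source_gen_Z: "twist_gen a - source_gen a \<in> Z"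
proof -
  have "phi (H.rep_mult (twist_gen a - source_gen a) q) = 0" if "q \<in> B_reps" for q
    using phi_B_reps[OF that] by (auto simp: H.rep_mult_left phi_lin phi_twist_gen phi_source_gen)
  then show ?thesis
    by (simp add: Z_def twist_source_gen_I free.subspace_diff[OF subspace_B_reps] gens_B_reps)
qed

lemma Z_phi: "z \<in> Z \<Longrightarrow> phi z = 0"
proof -
  assume z: "z \<in> Z"
  have "gen (1, 1) \<in> B_reps" using gens_B_reps(1)[of 1] by (simp add: source_gen_def al_one)
  with z have "phi (H.rep_mult z (gen (1, 1))) = 0" unfolding Z_def by blast
  then show "phi z = 0" by (simp add: H.rep_mult_one)
qed

lemma B_reps_decomposition: assumes "p \<in> B_reps" obtains h where "p - E h \<in> Z"
proof -
  let ?D = "{p. \<exists>h. p - E h \<in> Z}"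
  have mod: "E h - u \<in> H.N \<Longrightarrow> p - u \<in> Z \<Longrightarrow> p - E h \<in> Z" for p u h
    using free.subspace_diff[OF subspace_Z, of "p - u" "E h - u"] N_subset_Z by auto
  have E0: "E 0 - 0 \<in> H.N"
    and Eadd: "E (h + h') - (E h + E h') \<in> H.N" and Esc: "E (sH c h) - fscale c (E h) \<in> H.N" for h h' c
    unfolding H.qprN_eq_iff[symmetric] lin_add[OF H.lin_qprN] lin_zero[OF H.lin_qprN] lin_scale[OF H.lin_qprN]
    by (rule lin_zero lin_add lin_scale; rule lin_qprN_E)+
  have "B_reps \<subseteq> ?D"
  proof (rule B_reps_induct)
    show "free.subspace ?D"
    proof (unfold free.subspace_def, intro conjI ballI allI)
      show "0 \<in> ?D" using mod[OF E0, of 0] free.subspace_0[OF subspace_Z] by auto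
      fix x y c assume "x \<in> ?D"
      then obtain h where h: "x - E h \<in> Z" by blast
      then have "fscale c x - E (sH c h) \<in> Z"
        using mod[OF Esc, of "fscale c x" c h] free.subspace_scale[OF subspace_Z h, of c]
        by (simp add: free.scale_right_diff_distrib)
      then show "fscale c x \<in> ?D" by blast
      assume "y \<in> ?D"
      then obtain h' where h': "y - E h' \<in> Z" by blast
      have "x + y - E (h + h') \<in> Z"
        using mod[OF Eadd, of "x + y" h h'] free.subspace_add[OF subspace_Z h h'] by (simp add: algebra_simps)
      then show "x + y \<in> ?D" by blast
    qed
    show "H.N \<subseteq> ?D"
      using mod[OF E0] N_subset_Z by auto
    show "H.rep_mult p q \<in> ?D" if pq: "p \<in> ?D" "q \<in> ?D" for p q
    proof -
      obtain h h' where h: "p - E h \<in> Z" "q - E h' \<in> Z" using pq by blast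
      \<comment> \<open>Right multiplication of \<open>Z\<close> by \<open>q\<close> needs
        \<open>q\<close> in B, which is recovered from its decomposition.\<close>
      have "q = (q - E h') + E h'" by simp
      then have "q \<in> B_reps"
        using free.subspace_add[OF subspace_B_reps _ E_B_reps, of "q - E h'" h'] h(2) by (auto simp: Z_def)
      then have "H.rep_mult (p - E h) q + H.rep_mult (E h) (q - E h') \<in> Z"
        by (intro free.subspace_add[OF subspace_Z] Z_ideal h E_B_reps)
      then have "H.rep_mult p q - H.rep_mult (E h) (E h') \<in> Z" by (simp add: H.rep_mult_left H.rep_mult_right)
      moreover have "H.rep_mult (E h) (E h') - E (h * h') \<in> Z" using E_mult_mod N_subset_Z by blast
      ultimately have "H.rep_mult p q - E (h * h') \<in> Z"
        using free.subspace_add[OF subspace_Z] by fastforce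
      then show ?thesis by blast
    qed
    show "source_gen a \<in> ?D" for a using E_mod(1)[of a] N_subset_Z by blast
    show "comult_gen t \<in> ?D" for t using E_mod(2)[of t] N_subset_Z by blast
    show "twist_gen a \<in> ?D" for a
    proof -
      have "source_gen a - E (al a) \<in> Z" using E_mod(1)[of a] N_subset_Z by blast
      then have "twist_gen a - E (al a) \<in> Z"
        using free.subspace_add[OF subspace_Z twist_source_gen_Z, of "source_gen a - E (al a)" a] by simp
      then show ?thesis by blast
    qed
  qed
  with assms that show ?thesis by blast
qed

text \<open>The counit provides a retraction of \<open>E\<close> which, by \<open>counit_I\<close>,
  also kills I_A. Thus E(h) lies in I_A only for h = 0.\<close>

lemma counit_E: "lin_ext sH (\<lambda>(x, y). al (eps x) * y) (E h) = h"
proof (rule smash_linear_eqI[where s = sH and F = "\<lambda>h. lin_ext sH (\<lambda>(x, y). al (eps x) * y) (E h)" and G = "\<lambda>h. h"])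
  note l = lin_lin_ext[OF H.vector_space_axioms]
  show "lin sH sH (\<lambda>h. lin_ext sH (\<lambda>(x, y). al (eps x) * y) (E h))"
    by (rule lin_E[OF l]) (simp_all add: lin_ext_gen H.vector_space_axioms lin_intros)
  have "lin_ext sH (\<lambda>(x, y). al (eps x) * y) (E (al a * io t)) =
      sw sH t (\<lambda>t1 t2. al (eps (al a * io t1)) * io t2)" for a t
    by (subst E_sharp[OF l]) (simp_all add: lin_ext_gen H.vector_space_axioms lin_intros)
  also have "\<dots> a t = al a * io t" for a t
    using sw_counit_left[of sH "\<lambda>t. al a * io t" t]
    by (simp add: eps_sharp lin_scale[OF lin_al] H.scale_mult_left lin_intros)
  finally show "lin_ext sH (\<lambda>(x, y). al (eps x) * y) (E (al a * io t)) = al a * io t" for a t .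
qed (intro lin_intros)

lemma counit_I: "p \<in> I \<Longrightarrow> lin_ext sH (\<lambda>(x, y). al (eps x) * y) p = 0"
  by (rule balanced_ext_zero) (intro lin_intros | simp add: eps_be al_mult mult.assoc)+

lemma B_reps_I_Z: assumes "p \<in> B_reps" "p \<in> I" shows "p \<in> Z"
proof -
  obtain h where h: "p - E h \<in> Z" using B_reps_decomposition[OF assms(1)] .
  then have "E h \<in> I" using free.subspace_diff[OF subspace_I assms(2), of "p - E h"] by (simp add: Z_def)
  then have "h = 0" using counit_I[of "E h"] by (simp add: counit_E)
  moreover have "E 0 \<in> H.N" using lin_zero[OF lin_qprN_E] by (simp add: H.qprN_eq_0)
  ultimately have "E h \<in> Z" using N_subset_Z by blast
  then show ?thesis using free.subspace_add[OF subspace_Z h, of "E h"] by simp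
qed

end

section \<open>The Hopf algebroid\<close>

context scalar_extension
begin

abbreviation Delta where "Delta \<equiv> ext_comult sH sharp Dl rho"

lemma Delta_eq: "Delta h = qcls I (E h)"
  by (simp add: ext_comult_def E_def)

text \<open>\<open>f\<close> is a test map factoring through H \<otimes>_A H. Statements about
  \<open>Delta\<close> are proved for all such \<open>f\<close> and then specialised, for instance
  to \<open>tI\<close>.\<close>

context
  fixes s :: "'k \<Rightarrow> 'z::ab_group_add \<Rightarrow> 'z" and f :: "'h \<Rightarrow> 'h \<Rightarrow> 'z"
  assumes f_left: "\<And>y. lin sH s (\<lambda>x. f x y)" and f_right: "\<And>x. lin sH s (f x)"
    and f_balanced: "\<And>a x y. f (be a * x) y = f x (al a * y)"
begin

lemma vs_target: "vector_space s"
  by (rule lin_vs2[OF f_right])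

lemma lift_Delta_E: "lift s f (Delta h) = lin_ext s (\<lambda>(x, y). f x y) (E h)"
  unfolding Delta_eq
  by (rule lift_eq[OF vs_target subspace_I balanced_ext_zero[OF f_left f_right f_balanced]])

lemma lin_lift_Delta: "lin sH s (\<lambda>h. lift s f (Delta h))"
  unfolding lift_Delta_E
  by (rule lin_E) (simp_all add: lin_lin_ext lin_ext_gen vs_target f_left f_right)

lemma lift_Delta_sharp: "lift s f (Delta (al a * io t)) = sw s t (\<lambda>t1 t2. f (al a * io t1) (io t2))"
  unfolding lift_Delta_E
  by (subst E_sharp[OF lin_lin_ext]) (simp_all add: lin_ext_gen vs_target f_left f_right)

lemma lift_Delta_bimod:
  "lift s f (Delta (be b * (al a * h))) = lift s (\<lambda>x y. f (al a * x) (be b * y)) (Delta h)"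
proof -
  note f_lin = lin_comp[OF f_left] lin_comp[OF f_right]
  have e: "lift s (\<lambda>x y. f (al a * x) (be b * y)) (Delta h) = lin_ext s (\<lambda>(x, y). f (al a * x) (be b * y)) (E h)" for h
    unfolding Delta_eq
  proof (rule lift_eq[OF vs_target subspace_I balanced_ext_zero])
    show "f (al a * (be c * x)) (be b * y) = f (al a * x) (be b * (al c * y))" for c x y
      using f_balanced[of c "al a * x" "be b * y"] by (simp only: be_al mult.assoc[symmetric])
  qed (intro f_lin lin_intros | assumption)+
  show ?thesis
    unfolding e
  proof (rule smash_linear_eqI[where s = s and F = "\<lambda>h. lift s f (Delta (be b * (al a * h)))"
        and G = "\<lambda>h. lin_ext s (\<lambda>(x, y). f (al a * x) (be b * y)) (E h)"])
    show "lin sH s (\<lambda>h. lift s f (Delta (be b * (al a * h))))"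
      by (rule lin_comp[OF lin_lift_Delta]) (intro lin_intros)
    show "lin sH s (\<lambda>h. lin_ext s (\<lambda>(x, y). f (al a * x) (be b * y)) (E h))"
      by (rule lin_E[OF lin_lin_ext[OF vs_target]]) (simp_all add: lin_ext_gen vs_target f_lin lin_intros)
    fix c t
    let ?a = "a * c"
    have "be b * (al a * (al c * io t)) = al ?a * be b * io t"
    proof -
      have "be b * (al a * (al c * io t)) = be b * al ?a * io t" by (simp add: al_mult mult.assoc)
      then show ?thesis by (simp only: be_al)
    qed
    also have "\<dots> = cw sH b (\<lambda>b0 b1. al (?a * b0) * io (b1 * t))"
      by (simp add: be_eq lift_mult_left lift_mult_right al_mult io_mult mult.assoc)
    finally have "lift s f (Delta (be b * (al a * (al c * io t)))) =
        cw s b (\<lambda>b0 b1. sw s (b1 * t) (\<lambda>u v. f (al (?a * b0) * io u) (io v)))"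
      by (simp only: lift_commute[OF lin_lift_Delta] lift_Delta_sharp)
    also have "\<dots> = cw s b (\<lambda>b0 b1. sw s b1 (\<lambda>x y. sw s t (\<lambda>t1 t2. f (al (?a * b0) * io (x * t1)) (io (y * t2)))))"
      by (subst sw_mult) (intro lin_intros f_lin | rule refl)+
    also have "\<dots> = cw s b (\<lambda>b0 b1. cw s b0 (\<lambda>b00 b01. sw s t (\<lambda>t1 t2. f (al (?a * b00) * io (b01 * t1)) (io (b1 * t2)))))"
      by (subst cw_coassoc) (intro lin_intros f_lin vs_target | rule refl)+
    also have "\<dots> = cw s b (\<lambda>b0 b1. sw s t (\<lambda>t1 t2. cw s b0 (\<lambda>b00 b01. f (al (?a * b00) * io (b01 * t1)) (io (b1 * t2)))))"
      by (subst lift_swap[OF vs_target]) (rule refl)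
    \<comment> \<open>The pair b00, b01 assembles to \<beta>(b0), which crosses the tensor sign as
      \<alpha>(b0) and forms \<beta>(b) with b1 there.\<close>
    also have "\<dots> = cw s b (\<lambda>b0 b1. sw s t (\<lambda>t1 t2. f (al ?a * io t1) (al b0 * io b1 * io t2)))"
    proof -
      have "cw s b0 (\<lambda>b00 b01. f (al (?a * b00) * io (b01 * t1)) y) = f (al ?a * io t1) (al b0 * y)" for b0 t1 y
      proof -
        have "cw sH b0 (\<lambda>b00 b01. al (?a * b00) * io (b01 * t1)) = al ?a * be b0 * io t1"
          by (simp add: be_eq lift_mult_left lift_mult_right al_mult io_mult mult.assoc)
        also have "\<dots> = be b0 * (al ?a * io t1)"
          by (simp only: be_al[symmetric] mult.assoc)
        finally show ?thesis
          by (simp only: f_balanced[symmetric] lift_commute[OF f_left, symmetric])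
      qed
      then show ?thesis by (simp only: io_mult mult.assoc)
    qed
    also have "\<dots> = sw s t (\<lambda>t1 t2. cw s b (\<lambda>b0 b1. f (al ?a * io t1) (al b0 * io b1 * io t2)))"
      by (rule lift_swap[OF vs_target])
    also have "\<dots> = sw s t (\<lambda>t1 t2. f (al a * (al c * io t1)) (be b * io t2))"
      by (simp only: be_eq lift_mult_right lift_commute[OF f_right] al_mult mult.assoc)
    also have "\<dots> = lin_ext s (\<lambda>(x, y). f (al a * x) (be b * y)) (E (al c * io t))"
      by (subst E_sharp[OF lin_lin_ext]) (simp_all add: lin_ext_gen vs_target f_lin lin_intros)
    finally show "lift s f (Delta (be b * (al a * (al c * io t)))) =
      lin_ext s (\<lambda>(x, y). f (al a * x) (be b * y)) (E (al c * io t))" .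
  qed
qed

lemma lift_Delta_al: "lift s f (Delta (al a * h)) = lift s (\<lambda>x y. f (al a * x) y) (Delta h)"
  and lift_Delta_be: "lift s f (Delta (be b * h)) = lift s (\<lambda>x y. f x (be b * y)) (Delta h)"
  using lift_Delta_bimod[of 1 a h] lift_Delta_bimod[of b 1 h] by (simp_all add: al_one be_one)

end

section \<open>The bialgebroid axioms\<close>

lemma enveloping: "enveloping_ring sA sH al be"
proof unfold_locales
  show "algebra_hom sA sH al"
    using lin_al by (simp add: algebra_hom_def al_one al_mult)
  show "algebra_antihom sA sH be"
    using lin_be by (simp add: algebra_antihom_def be_one be_mult)
  show "al a * be b = be b * al a" for a b
    by (rule be_al[symmetric])
qed

lemma Delta_coassoc:
  "qcls (balanced3_rel sH (lact al) (ract be))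
     (lift fscale (\<lambda>x y. lift fscale (\<lambda>x1 x2. gen (x1, x2, y)) (Delta x)) (Delta h)) =
   qcls (balanced3_rel sH (lact al) (ract be))
     (lift fscale (\<lambda>x y. lift fscale (\<lambda>y1 y2. gen (x, y1, y2)) (Delta y)) (Delta h))"
proof -
  let ?U = "balanced3_rel sH (lact al) (ract be)"
  define t3 where "t3 x y z = qpr ?U (gen (x, y, z))" for x y z
  note U = subspace_balanced3_rel[of sH "lact al" "ract be"]
  note q = qpr_eq_0[OF U] and l = lin_qpr[OF U]
  have r: "r \<in> trilin_rels sH sH sH \<Longrightarrow> qpr ?U r = 0" for r
    unfolding q by (simp add: balanced3_rel_def free.span_base)
  have ta1: "t3 (x + x') y z - t3 x y z - t3 x' y z = 0" for x x' y z
    unfolding t3_def lin_diff[OF l, symmetric] lin_scale[OF l, symmetric]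
    by (rule r, unfold trilin_rels_def, rule UnI1, rule UnI1, rule UnI1, rule UnI1, rule UnI1, blast)
  have ts1: "t3 (sH c x) y z - fscale c (t3 x y z) = 0" for c x y z
    unfolding t3_def lin_diff[OF l, symmetric] lin_scale[OF l, symmetric]
    by (rule r, unfold trilin_rels_def, rule UnI1, rule UnI1, rule UnI2, blast)
  have ta2: "t3 x (y + y') z - t3 x y z - t3 x y' z = 0" for x y y' z
    unfolding t3_def lin_diff[OF l, symmetric] lin_scale[OF l, symmetric]
    by (rule r, unfold trilin_rels_def, rule UnI1, rule UnI1, rule UnI1, rule UnI1, rule UnI2, blast)
  have ts2: "t3 x (sH c y) z - fscale c (t3 x y z) = 0" for c x y z
    unfolding t3_def lin_diff[OF l, symmetric] lin_scale[OF l, symmetric]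
    by (rule r, unfold trilin_rels_def, rule UnI1, rule UnI2, blast)
  have ta3: "t3 x y (z + z') - t3 x y z - t3 x y z' = 0" for x y z z'
    unfolding t3_def lin_diff[OF l, symmetric] lin_scale[OF l, symmetric]
    by (rule r, unfold trilin_rels_def, rule UnI1, rule UnI1, rule UnI1, rule UnI2, blast)
  have ts3: "t3 x y (sH c z) - fscale c (t3 x y z) = 0" for c x y z
    unfolding t3_def lin_diff[OF l, symmetric] lin_scale[OF l, symmetric]
    by (rule r, unfold trilin_rels_def, rule UnI2, blast)
  have l1: "lin sH fscale (\<lambda>x. t3 x y z)" for y z
    using ta1 ts1 by (intro linI lin_intros) (simp_all add: algebra_simps)
  have l2: "lin sH fscale (\<lambda>y. t3 x y z)" for x z
    using ta2 ts2 by (intro linI lin_intros) (simp_all add: algebra_simps)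
  have l3: "lin sH fscale (\<lambda>z. t3 x y z)" for x y
    using ta3 ts3 by (intro linI lin_intros) (simp_all add: algebra_simps)
  note t_lin = l1[THEN lin_comp] l2[THEN lin_comp] l3[THEN lin_comp]
  have b1: "t3 (be a * x) y z = t3 x (al a * y) z" for a x y z
  proof -
    have "gen (be a * x, y, z) - gen (x, al a * y, z) \<in> ?U"
      unfolding balanced3_rel_def lact_def ract_def by (rule free.span_base) blast
    then show ?thesis by (simp add: t3_def qpr_eq_iff[OF U])
  qed
  have b2: "t3 x (be a * y) z = t3 x y (al a * z)" for a x y z
  proof -
    have "gen (x, be a * y, z) - gen (x, y, al a * z) \<in> ?U"
      unfolding balanced3_rel_def lact_def ract_def by (rule free.span_base) blast
    then show ?thesis by (simp add: t3_def qpr_eq_iff[OF U])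
  qed
  \<comment> \<open>Both iterated coproducts are written as \<open>lift\<close> of a map on pairs.
    Once \<open>L\<close> and \<open>R\<close> are shown to be balanced, they serve as test maps,
    and on a # t the claim reduces to coassociativity of T.\<close>
  define L where "L x y = lift fscale (\<lambda>x1 x2. t3 x1 x2 y) (Delta x)" for x y
  define R where "R x y = lift fscale (\<lambda>y1 y2. t3 x y1 y2) (Delta y)" for x y
  have L1: "lin sH fscale (\<lambda>x. L x y)" for y
    unfolding L_def by (rule lin_lift_Delta) (rule l1 l2 b1)+
  have L2: "lin sH fscale (L x)" for x
    unfolding L_def[abs_def] by (intro lin_intros l3)
  have Lb: "L (be a * x) y = L x (al a * y)" for a x y
    unfolding L_def by (subst lift_Delta_be) (rule l1 l2 b1 | simp add: b2)+
  have R1: "lin sH fscale (\<lambda>x. R x y)" for y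
    unfolding R_def by (intro lin_intros l1)
  have R2: "lin sH fscale (R x)" for x
    unfolding R_def[abs_def] by (rule lin_lift_Delta) (rule l2 l3 b2)+
  have b1_fun: "t3 (be a * x) = (\<lambda>y. t3 x (al a * y))" for a x
    by (intro ext b1)
  have Rb: "R (be a * x) y = R x (al a * y)" for a x y
    unfolding R_def by (subst lift_Delta_al) (rule l2 l3 b2 | simp add: b1_fun)+
  have Ls: "L (al a * io t) y = sw fscale t (\<lambda>t1 t2. t3 (al a * io t1) (io t2) y)" for a t y
    unfolding L_def by (rule lift_Delta_sharp) (rule l1 l2 b1)+
  have Rs: "R x (io t) = sw fscale t (\<lambda>t1 t2. t3 x (io t1) (io t2))" for x t
    using lift_Delta_sharp[where f = "\<lambda>y1 y2. t3 x y1 y2" and a = 1 and t = t, OF l2 l3 b2]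
    by (simp add: R_def al_one)
  have "lift fscale L (Delta h) = lift fscale R (Delta h)"
  proof (rule smash_linear_eqI[where s = fscale and F = "\<lambda>h. lift fscale L (Delta h)" and G = "\<lambda>h. lift fscale R (Delta h)"])
    show "lift fscale L (Delta (al a * io t)) = lift fscale R (Delta (al a * io t))" for a t
    proof -
      have "lift fscale L (Delta (al a * io t)) =
          sw fscale t (\<lambda>t1 t2. sw fscale t1 (\<lambda>x y. t3 (al a * io x) (io y) (io t2)))"
        by (simp add: lift_Delta_sharp[OF L1 L2 Lb] Ls)
      also have "\<dots> = sw fscale t (\<lambda>t1 t2. sw fscale t2 (\<lambda>x y. t3 (al a * io t1) (io x) (io y)))"
        by (rule sw_coassoc) (intro lin_intros t_lin)+
      also have "\<dots> = lift fscale R (Delta (al a * io t))"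
        by (simp add: lift_Delta_sharp[OF R1 R2 Rb] Rs)
      finally show ?thesis .
    qed
  qed (rule lin_lift_Delta; rule L1 L2 Lb R1 R2 Rb)+
  then show ?thesis
    by (simp only: qcls_eq_qpr[OF U] lift_commute[OF l] L_def[abs_def] R_def[abs_def] t3_def[abs_def])
qed

lemma coring: "a_coring sA sH (lact al) (ract be) Delta eps"
proof (intro a_coring.intro a_coring_axioms.intro A.k_algebra_axioms H.vector_space_axioms)
  show "left_action sA sH (lact al)"
    unfolding left_action_def bilinear_map_def lact_def
    by (auto simp: al_one al_mult mult.assoc intro!: lin_intros)
  show "right_action sA sH (ract be)"
    unfolding right_action_def bilinear_map_def ract_def
    by (auto simp: be_one be_mult mult.assoc intro!: lin_intros)
  show "ract be (lact al a h) b = lact al a (ract be h b)" for a h b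
    by (simp add: lact_def ract_def be_al flip: mult.assoc)
  have lE: "lin sH fscale (\<lambda>h. qpr I (E h))"
    by (rule lin_E[OF lin_qprI]) (intro lin_tI_left[unfolded tI_def] lin_tI_right[unfolded tI_def])+
  show "quot_linear sH I Delta"
    unfolding Delta_eq[abs_def]
    by (rule quot_linearI[OF subspace_I H.vector_space_axioms])
      (simp_all add: lin_add[OF lE] lin_scale[OF lE] lin_add[OF lin_qprI] lin_scale[OF lin_qprI]
        flip: qpr_eq_iff[OF subspace_I])
  show "Delta (ract be (lact al a h) b) =
      qcls I (lift fscale (\<lambda>x y. gen (lact al a x, ract be y b)) (Delta h))" for a h b
  proof -
    \<comment> \<open>This turns the coset equation into an equation for the test map
      \<open>tI\<close>.\<close>
    have "qpr I (E h') = lift fscale tI (Delta h')" for h'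
      unfolding lift_Delta_E[OF lin_tI_left lin_tI_right tI_balanced] tI_def
      by (subst lin_free_eq[OF lin_qprI]) (simp add: case_prod_unfold)
    then show ?thesis
      unfolding Delta_eq[of "ract be (lact al a h) b"] qcls_eq_qpr[OF subspace_I]
      by (simp add: lact_def ract_def lift_Delta_bimod[OF lin_tI_left lin_tI_right tI_balanced] lift_commute[OF lin_qprI] flip: tI_def)
  qed
  show "lin sH sA eps" by (rule lin_eps)
  show "eps (ract be (lact al a h) b) = a * eps h * b" for a h b
    by (simp add: lact_def ract_def eps_be eps_al)
  show "lift sH (\<lambda>x y. lact al (eps x) y) (Delta h) = h" for h
  proof -
    have "lift sH (\<lambda>x y. al (eps x) * y) (Delta h) = lin_ext sH (\<lambda>(x, y). al (eps x) * y) (E h)"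
      by (rule lift_Delta_E) (intro lin_intros | simp add: eps_be al_mult mult.assoc)+
    then show ?thesis by (simp add: lact_def counit_E)
  qed
  show "lift sH (\<lambda>x y. ract be x (eps y)) (Delta h) = h" for h
    unfolding ract_def
  proof (rule smash_linear_eqI[where s = sH and F = "\<lambda>h. lift sH (\<lambda>x y. be (eps y) * x) (Delta h)" and G = "\<lambda>h. h"])
    show "lin sH sH (\<lambda>h. lift sH (\<lambda>x y. be (eps y) * x) (Delta h))"
      by (rule lin_lift_Delta) (intro lin_intros | simp add: eps_al be_mult mult.assoc)+
    show "lift sH (\<lambda>x y. be (eps y) * x) (Delta (al a * io t)) = al a * io t" for a t
    proof -
      have "lift sH (\<lambda>x y. be (eps y) * x) (Delta (al a * io t)) =
          sw sH t (\<lambda>t1 t2. be (eps (io t2)) * (al a * io t1))"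
        by (rule lift_Delta_sharp) (intro lin_intros | simp add: eps_al be_mult mult.assoc)+
      also have "\<dots> = al a * io t"
        using eps_sharp[of 1] sw_counit_right[of sH "\<lambda>t. al a * io t" t]
        by (simp add: al_one lin_scale[OF lin_be] be_one H.scale_mult_left lin_intros)
      finally show ?thesis .
    qed
  qed (intro lin_intros)
qed (rule Delta_coassoc)

text \<open>The element a # t acts by v \<mapsto> \<open>a * act t v\<close>, so compatibility with
  products is the module algebra axiom.\<close>

lemma eps_left_action: "left_action sH sA (\<lambda>h a. eps (h * al a))"
  unfolding left_action_def bilinear_map_def
proof (intro conjI allI)
  fix x y v
  have 1: "eps (al a * io t * (al a' * io t') * al v) = eps (al a * io t * al (eps (al a' * io t' * al v)))"
    for a t a' t'
  proof -
    have "eps (al a * io t * (al a' * io t') * al v) = sw sA t (\<lambda>t1 t2. a * act t1 a' * act (t2 * t') v)"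
      by (simp only: sharp_mult_sharp lift_mult_right lift_commute[OF lin_eps] eps_action)
    also have "\<dots> = a * sw sA t (\<lambda>t1 t2. act t1 a' * act (t2 * t') v)"
      by (subst lift_commute[of sA sA "\<lambda>z. a * z"]) (intro lin_intros | simp add: mult.assoc)+
    finally show ?thesis by (simp add: eps_action action_mult act_mult)
  qed
  have 2: "eps (al a * io t * y * al v) = eps (al a * io t * al (eps (y * al v)))" for a t
    by (rule smash_linear_eqI[where s = sA and F = "\<lambda>y. eps (al a * io t * y * al v)"]) (intro lin_intros | rule 1)+
  show "eps (x * y * al v) = eps (x * al (eps (y * al v)))"
    by (rule smash_linear_eqI[where s = sA and F = "\<lambda>x. eps (x * y * al v)"]) (intro lin_intros | rule 2)+
  show "eps (1 * al v) = v"
    using eps_al[of v 1] by (simp add: eps_one)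
qed (intro lin_intros)+

lemma proj_tcls: "proj sH al be (tcls sH sH p) = qcls I p"
  using rep_qcls[OF subspace_N, of p] N_subset_I by (auto simp: proj_def qcls_eq_iff[OF subspace_I])

lemma tcls_kernel_proj: "tcls sH sH p \<in> kernel_proj sH al be \<longleftrightarrow> p \<in> I"
  by (simp add: kernel_proj_def proj_tcls qcls_eq_iff[OF subspace_I])

lemma B_obtain:
  assumes "P \<in> B" obtains p where "P = tcls sH sH p" "p \<in> B_reps"
  using assms B_subset unfolding H.reps_def by blast

lemma bialgebroid: "bialgebroid_balancing sA sH al be Delta eps B"
proof (intro bialgebroid_balancing.intro enveloping coring bialgebroid_balancing_axioms.intro)
  show "tensor_subalgebra sH B" by (rule B_subalgebra)
  show "left_action sH sA (\<lambda>h a. eps (h * al a))" by (rule eps_left_action)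
  have "H.reps (kernel_proj sH al be \<inter> B) = I \<inter> B_reps"
    by (auto simp: H.reps_def tcls_kernel_proj)
  then show "tensor_ideal sH B (kernel_proj sH al be \<inter> B)"
    unfolding H.tensor_ideal_iff[OF B_subset]
    by (auto simp: free.subspace_inter subspace_I subspace_B_reps B_reps_I I_right_ideal B_reps_mult)
  show "range Delta \<subseteq> proj sH al be ` B"
  proof (intro subsetI, elim rangeE)
    fix P h assume "P = Delta h"
    then have "P = proj sH al be (tcls sH sH (E h))" by (simp add: proj_tcls Delta_eq)
    then show "P \<in> proj sH al be ` B" using E_B_reps[of h] unfolding H.reps_def by blast
  qed
  have "E 1 - gen (1, 1) \<in> H.N"
    using E_al[of 1] by (simp add: al_one H.tN_def flip: H.qprN_eq_iff)
  then show "Delta 1 = qcls I (gen (1, 1))"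
    using N_subset_I by (auto simp: Delta_eq qcls_eq_iff[OF subspace_I])
  fix P Q h h'
  assume "P \<in> B" "Q \<in> B" and PQ: "proj sH al be P = Delta h" "proj sH al be Q = Delta h'"
  then obtain p q where p: "P = tcls sH sH p" "p \<in> B_reps" and q: "Q = tcls sH sH q" "q \<in> B_reps"
    by (metis B_obtain)
  have I: "p - E h \<in> I" "q - E h' \<in> I"
    using PQ by (simp_all add: p q proj_tcls Delta_eq qcls_eq_iff[OF subspace_I])
  \<comment> \<open>The telescoped difference: the first term needs stability of I_A under B on the
    left, the second the right ideal property. This covers arbitrary representatives in B.\<close>
  have "H.rep_mult p (q - E h') + H.rep_mult (p - E h) (E h') + (H.rep_mult (E h) (E h') - E (h * h')) \<in> I"
    using E_mult_mod N_subset_I by (intro free.subspace_add[OF subspace_I] B_reps_I I_right_ideal p I) auto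
  then have "H.rep_mult p q - E (h * h') \<in> I" by (simp add: H.rep_mult_left H.rep_mult_right)
  then show "proj sH al be (tmult sH sH (*) (*) P Q) = Delta (h * h')"
    by (simp add: p q H.tmult_tcls proj_tcls Delta_eq qcls_eq_iff[OF subspace_I])
qed

section \<open>The antipode axioms and the ideal generated by the differences\<close>

lemma phi_E: "phi (E h) = al (eps h)"
proof (rule smash_linear_eqI[where s = sH and F = "\<lambda>h. phi (E h)" and G = "\<lambda>h. al (eps h)"])
  show "lin sH sH (\<lambda>h. phi (E h))"
    by (rule lin_E[OF lin_phi]) (unfold phi_gen, (intro lin_intros)+)
  show "phi (E (al a * io t)) = al (eps (al a * io t))" for a t
  proof -
    have "phi (E (al a * io t)) = sw sH t (\<lambda>t1 t2. phi (gen (al a * io t1, io t2)))"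
      by (rule E_sharp[OF lin_phi]) (unfold phi_gen, (intro lin_intros)+)
    also have "\<dots> = sw sH t (\<lambda>t1 t2. al a * io (t1 * S t2))"
      by (simp add: phi_gen ta_io io_mult mult.assoc)
    also have "\<dots> = al (eps (al a * io t))"
      using sw_antipode_right[of sH "\<lambda>z. al a * io z" t]
      by (simp add: lin_intros io_one eps_sharp lin_scale[OF lin_al])
    finally show ?thesis .
  qed
qed (intro lin_intros)

lemma hopf_algebroid: "hopf_algebroid_balancing sA sH al be Delta eps B ta"
proof (intro hopf_algebroid_balancing.intro bialgebroid hopf_algebroid_balancing_axioms.intro)
  show "algebra_antihom sH sH ta"
    using lin_ta by (simp add: algebra_antihom_def ta_one ta_mult)
  show "lift sH (\<lambda>x y. x * ta y) P = 0" if "P \<in> kernel_proj sH al be \<inter> B" for P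
  proof -
    have "P \<in> B" using that by blast
    then obtain p where "P = tcls sH sH p" "p \<in> B_reps" by (rule B_obtain)
    with that show ?thesis by (simp add: lift_phi tcls_kernel_proj Z_phi B_reps_I_Z)
  qed
  show "ta (be a) = al a" for a by (rule ta_be)
  show "lift sH (\<lambda>x y. x * ta y) P = al (eps h)" if "P \<in> B" "proj sH al be P = Delta h" for P h
  proof -
    note P = that
    obtain p where p: "P = tcls sH sH p" "p \<in> B_reps" using P(1) by (rule B_obtain)
    \<comment> \<open>Any representative in B differs from \<open>E h\<close> by an element of both
      I_A and B, on which \<phi> vanishes.\<close>
    have "p - E h \<in> I" using P(2) by (simp add: p proj_tcls Delta_eq qcls_eq_iff[OF subspace_I])
    then have "phi (p - E h) = 0"
      by (intro Z_phi B_reps_I_Z free.subspace_diff[OF subspace_B_reps] p E_B_reps)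
    then show ?thesis by (simp add: p lift_phi phi_lin phi_E)
  qed
  show "lift sH (\<lambda>x y. ta x * y) (Delta h) = be (eps (ta h))" for h
  proof (rule smash_linear_eqI[where s = sH and F = "\<lambda>h. lift sH (\<lambda>x y. ta x * y) (Delta h)" and G = "\<lambda>h. be (eps (ta h))"])
    show "lin sH sH (\<lambda>h. lift sH (\<lambda>x y. ta x * y) (Delta h))"
      by (rule lin_lift_Delta) (intro lin_intros | simp add: ta_mult ta_be mult.assoc)+
    show "lift sH (\<lambda>x y. ta x * y) (Delta (al a * io t)) = be (eps (ta (al a * io t)))" for a t
      unfolding antipode_left_sharp[symmetric]
      by (rule lift_Delta_sharp) (intro lin_intros | simp add: ta_mult ta_be mult.assoc)+
  qed (intro lin_intros)
qed

text \<open>\<open>Z\<close> is an ideal containing the generating differences, so minimality places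
  \<open>Bplus\<close> inside it.\<close>

lemma lift_Bplus: "(\<lambda>P. lift sH (\<lambda>x y. x * ta y) P) ` Bplus = {0}"
proof -
  have gens: "range (\<lambda>a. tcls sH sH (source_gen a - twist_gen a)) \<subseteq> B"
    using free.subspace_diff[OF subspace_B_reps gens_B_reps(1,2)] by (auto simp: H.reps_def)
  have ideal: "tensor_ideal sH B Bplus"
    unfolding Bplus_eq by (rule H.tensor_ideal_hull[OF B_subalgebra gens])
  have "source_gen a - twist_gen a \<in> Z" for a
    using free.subspace_neg[OF subspace_Z twist_source_gen_Z[of a]] by simp
  then have sub: "H.reps Bplus \<subseteq> Z"
    unfolding Bplus_eq
    by (intro H.reps_ideal_hull[OF subspace_Z N_subset_Z _ B_subset]) (auto simp: Z_ideal Z_def[THEN equalityD1, THEN subsetD, simplified])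
  have "lift sH (\<lambda>x y. x * ta y) P = 0" if "P \<in> Bplus" for P
  proof -
    have "P \<in> B" using ideal that unfolding tensor_ideal_def by blast
    then obtain p where p: "P = tcls sH sH p" by (rule B_obtain)
    then have "p \<in> Z" using sub that by (auto simp: H.reps_def)
    then show ?thesis by (simp add: p lift_phi Z_phi)
  qed
  then have "(\<lambda>P. lift sH (\<lambda>x y. x * ta y) P) ` Bplus = (\<lambda>P. 0) ` Bplus"
    by (rule image_cong[OF refl])
  \<comment> \<open>The image is all of {0} only because \<open>Bplus\<close> is nonempty.\<close>
  moreover have "tcls sH sH 0 \<in> Bplus"
    using ideal by (simp only: tensor_ideal_def tensor_subspace_def)
  ultimately show ?thesis by (metis empty_iff image_constant_conv)
qed

end

theorem theorem4p12:
  fixes sT :: "'k::field \<Rightarrow> 't::{ring,monoid_mult} \<Rightarrow> 't"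
    and Dl :: "'t \<Rightarrow> ('t \<times> 't \<Rightarrow>\<^sub>0 'k) set"
    and ep :: "'t \<Rightarrow> 'k"
    and S :: "'t \<Rightarrow> 't"
    and sA :: "'k \<Rightarrow> 'a::{ring,monoid_mult} \<Rightarrow> 'a"
    and act :: "'t \<Rightarrow> 'a \<Rightarrow> 'a"
    and rho :: "'a \<Rightarrow> ('a \<times> 't \<Rightarrow>\<^sub>0 'k) set"
    and sH :: "'k \<Rightarrow> 'h::{ring,monoid_mult} \<Rightarrow> 'h"
    and sharp :: "'a \<Rightarrow> 't \<Rightarrow> 'h"
  assumes "braided_commutative_yd_algebra sT Dl ep S sA act rho"
    and "bij S"
    and "smash_product sT Dl sA act sH sharp"
  shows "(\<lambda>P. lift sH (\<lambda>x y. x * ext_antipode sH sharp S rho y) P) `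
           balancing_plus sH sharp Dl S rho = {0} \<and>
         hopf_algebroid_balancing sA sH
           (ext_alpha sharp) (ext_beta sH sharp rho)
           (ext_comult sH sharp Dl rho) (ext_counit sA ep sH sharp)
           (balancing sH sharp Dl S rho) (ext_antipode sH sharp S rho)"
proof -
  interpret scalar_extension sT Dl ep S sA act rho sH sharp
    using assms(1,3) by (rule scalar_extension.intro)
  show ?thesis
    using lift_Bplus hopf_algebroid by blast
qed

end
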